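(* For $z\in\mathbb{R}$ let $$\mathscr{F}(z)=\left\{x\in(0,1)\setminus\mathbb{Q}\,:\,\limsup_{n\to\infty}\frac{-\log a_{n+1}}{\log\left|x-\frac{p_n}{q_n}\right|}=z\right\},$$ where $a_i=a_i(x)$ are the partial quotients and $\frac{p_n}{q_n}=\frac{p_n(x)}{q_n(x)}$ the convergents of the continued fraction expansion of $x$. Then for every $z$ with $0<z\le 1$, the Hausdorff dimension of $\mathscr{F}(z)$ is $1-z$ and $\mathcal{H}^{1-z}(\mathscr{F}(z))=\infty$. Moreover, if $z\notin[0,1]$, then $\mathscr{F}(z)=\emptyset$.
   Context: For irrational $x\in(0,1)$, write $x=[a_1,a_2,\ldots]=\cfrac{1}{a_1+\cfrac{1}{a_2+\cfrac{1}{a_3+\cdots}}}$ for its regular continued fraction expansion, with partial quotients $a_i\in\mathbb{Z}_{\ge1}$, and let $\frac{p_n}{q_n}=[a_1,\ldots,a_n]$ (in lowest terms, $q_n>0$) be its $n$-th convergent. $\mathcal{H}^s$ denotes $s$-dimensional Hausdorff measure (so $\mathcal{H}^0$ is counting measure). *)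

theory Defs
  imports "HOL-Analysis.Analysis"
begin

definition gauss_map :: "real \<Rightarrow> real" where
  "gauss_map x = frac (1 / x)"

text \<open>
  The partial quotients are indexed from 1, as in the expansion [a_1, a_2, ...];
  the value at index 0 is meaningless.
\<close>

definition partial_quotient :: "real \<Rightarrow> nat \<Rightarrow> int" where
  "partial_quotient x n = \<lfloor>1 / (gauss_map ^^ (n - 1)) x\<rfloor>"

fun cf_value :: "int list \<Rightarrow> real" where
  "cf_value [] = 0"
| "cf_value (a # as) = 1 / (of_int a + cf_value as)"

text \<open>The rational number p_n / q_n = [a_1, ..., a_n]; for n = 0 it is 0.\<close>

definition cf_convergent :: "real \<Rightarrow> nat \<Rightarrow> real" where
  "cf_convergent x n = cf_value (map (partial_quotient x) [1..<Suc n])"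

text \<open>
  The following facts confirm that the digits produced by the Gauss map are those of the
  expansion of x: they are positive and the finite continued fractions converge to x.
\<close>

lemma gauss_map_irrational:
  assumes "x \<notin> \<rat>"
  shows "gauss_map x \<in> {0<..<1} - \<rat>"
proof -
  have "1 / x \<notin> \<rat>"
    using assms by (metis Rats_1 Rats_divide div_by_1 divide_divide_eq_right mult_1)
  then have "frac (1 / x) \<notin> \<rat>"
    unfolding frac_def using Rats_add[of "1 / x - of_int \<lfloor>1 / x\<rfloor>" "of_int \<lfloor>1 / x\<rfloor>"] by auto
  moreover from this have "frac (1 / x) \<noteq> 0"
    by (metis Rats_0)
  ultimately show ?thesis
    using frac_ge_0[of "1 / x"] frac_lt_1[of "1 / x"] by (auto simp: gauss_map_def)
qed

lemma gauss_map_iterate: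
  assumes "x \<in> {0<..<1} - \<rat>"
  shows "(gauss_map ^^ n) x \<in> {0<..<1} - \<rat>"
  by (induction n) (use assms gauss_map_irrational in auto)

lemma partial_quotient_ge_1:
  assumes "x \<in> {0<..<1} - \<rat>"
  shows "partial_quotient x n \<ge> 1"
  using gauss_map_iterate[OF assms, of "n - 1"] by (simp add: partial_quotient_def)

lemma partial_quotient_gauss_map:
  assumes "n \<ge> 1"
  shows "partial_quotient (gauss_map x) n = partial_quotient x (Suc n)"
  using assms by (cases n) (auto simp: partial_quotient_def funpow_swap1)

lemma cf_convergent_Suc:
  "cf_convergent x (Suc n) =
     1 / (of_int (partial_quotient x 1) + cf_convergent (gauss_map x) n)"
proof -
  have "map (partial_quotient x) [1..<Suc (Suc n)] =
          partial_quotient x 1 # map (partial_quotient x) (map Suc [1..<Suc n])"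
    by (subst upt_conv_Cons) (simp_all add: map_Suc_upt del: upt_Suc)
  also have "map (partial_quotient x) (map Suc [1..<Suc n]) =
               map (partial_quotient (gauss_map x)) [1..<Suc n]"
    by (auto simp: partial_quotient_gauss_map simp del: upt_Suc)
  finally show ?thesis
    by (simp add: cf_convergent_def del: upt_Suc)
qed

lemma gauss_map_expand:
  "x = 1 / (of_int (partial_quotient x 1) + gauss_map x)"
  by (simp add: partial_quotient_def gauss_map_def frac_def)

lemma cf_convergent_range:
  assumes "x \<in> {0<..<1} - \<rat>"
  shows "cf_convergent x n \<in> {0..1}"
  using assms
proof (induction n arbitrary: x)
  case (Suc n)
  have "cf_convergent (gauss_map x) n \<in> {0..1}"
    using Suc gauss_map_irrational by blast
  moreover have "real_of_int (partial_quotient x 1) \<ge> 1"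
    using partial_quotient_ge_1[OF Suc.prems, of 1] by simp
  ultimately show ?case
    by (auto simp: cf_convergent_Suc divide_simps)
qed (simp add: cf_convergent_def)

lemma cf_convergent_error_step:
  assumes "x \<in> {0<..<1} - \<rat>"
  shows "\<bar>x - cf_convergent x (Suc n)\<bar> \<le> x * \<bar>gauss_map x - cf_convergent (gauss_map x) n\<bar>"
proof -
  define a y c where "a = real_of_int (partial_quotient x 1)"
    and "y = gauss_map x" and "c = cf_convergent (gauss_map x) n"
  have a: "a \<ge> 1"
    using partial_quotient_ge_1[OF assms, of 1] by (simp add: a_def)
  have y: "y > 0"
    using gauss_map_irrational assms by (auto simp: y_def)
  have c: "c \<ge> 0"
    using cf_convergent_range gauss_map_irrational assms by (auto simp: c_def)
  have x: "x = 1 / (a + y)"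
    unfolding a_def y_def by (rule gauss_map_expand)
  have eq: "x - 1 / (a + c) = x * (1 / (a + c)) * (c - y)"
    unfolding x using a y c by (simp add: field_simps)
  have "\<bar>x - 1 / (a + c)\<bar> = x * (1 / (a + c)) * \<bar>y - c\<bar>"
    unfolding eq using a y c assms by (simp add: abs_mult abs_minus_commute)
  also have "\<dots> \<le> x * 1 * \<bar>y - c\<bar>"
    by (intro mult_right_mono mult_left_mono) (use a c assms in auto)
  finally show ?thesis
    by (simp add: cf_convergent_Suc a_def y_def c_def)
qed

lemma gauss_map_product:
  assumes "x \<in> {0<..<1} - \<rat>"
  shows "x * gauss_map x \<le> 1 / 2"
proof -
  define a y where "a = real_of_int (partial_quotient x 1)" and "y = gauss_map x"
  have a: "a \<ge> 1"
    using partial_quotient_ge_1[OF assms, of 1] by (simp add: a_def)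
  have y: "y > 0" "y < 1"
    using gauss_map_irrational assms by (auto simp: y_def)
  have x: "x = 1 / (a + y)"
    unfolding a_def y_def by (rule gauss_map_expand)
  show ?thesis
    unfolding y_def[symmetric] unfolding x using a y by (simp add: field_simps)
qed

lemma cf_convergent_error:
  assumes "x \<in> {0<..<1} - \<rat>"
  shows "\<bar>x - cf_convergent x n\<bar> \<le> (1 / 2) ^ (n div 2)"
  using assms
proof (induction n arbitrary: x rule: less_induct)
  case (less n)
  show ?case
  proof (cases "n < 2")
    case True
    then show ?thesis
      using cf_convergent_range[OF less.prems, of n] less.prems by auto
  next
    case False
    then obtain m where n: "n = Suc (Suc m)"
      by (metis Suc_1 less_2_cases_iff not0_implies_Suc One_nat_def)
    define y where "y = gauss_map x"
    define w where "w = gauss_map y"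
    have y: "y \<in> {0<..<1} - \<rat>" and w: "w \<in> {0<..<1} - \<rat>"
      unfolding w_def y_def using gauss_map_irrational less.prems by auto
    have "\<bar>x - cf_convergent x n\<bar> \<le> x * \<bar>y - cf_convergent y (Suc m)\<bar>"
      unfolding n y_def by (rule cf_convergent_error_step[OF less.prems])
    also have "\<dots> \<le> x * (y * \<bar>w - cf_convergent w m\<bar>)"
      unfolding w_def
      by (intro mult_left_mono cf_convergent_error_step[OF y]) (use less.prems in auto)
    also have "\<dots> = (x * y) * \<bar>w - cf_convergent w m\<bar>"
      by simp
    also have "\<dots> \<le> (1 / 2) * (1 / 2) ^ (m div 2)"
      using gauss_map_product[OF less.prems] less.IH[OF _ w, of m] n
      by (intro mult_mono) (auto simp: y_def)
    also have "\<dots> = (1 / 2) ^ (n div 2)"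
      by (simp add: n)
    finally show ?thesis .
  qed
qed

lemma cf_convergent_tendsto:
  assumes "x \<in> {0<..<1} - \<rat>"
  shows "cf_convergent x \<longlonglongrightarrow> x"
proof -
  have "(\<lambda>n. (1 / 2 :: real) ^ n) \<longlonglongrightarrow> 0"
    by (rule LIMSEQ_realpow_zero) auto
  moreover have "filterlim (\<lambda>n::nat. n div 2) at_top at_top"
    unfolding filterlim_at_top
  proof
    fix Z :: nat
    show "eventually (\<lambda>n. Z \<le> n div 2) at_top"
      using eventually_ge_at_top[of "2 * Z"] by eventually_elim linarith
  qed
  ultimately have "(\<lambda>n. (1 / 2 :: real) ^ (n div 2)) \<longlonglongrightarrow> 0"
    by (rule filterlim_compose)
  then have "(\<lambda>n. cf_convergent x n - x) \<longlonglongrightarrow> 0"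
    by (rule Lim_null_comparison[rotated])
       (use cf_convergent_error[OF assms] in \<open>auto simp: abs_minus_commute\<close>)
  then show ?thesis
    by (simp add: LIM_zero_iff)
qed

text \<open>
  The empty set contributes 0 for every s, so finite covers are included. A nonempty set
  contributes 1 for s = 0 even if its diameter is 0 (in HOL, 0 powr 0 = 0); with this convention
  the 0-dimensional Hausdorff measure is counting measure.
\<close>

definition hausdorff_gauge :: "real \<Rightarrow> 'a::metric_space set \<Rightarrow> ennreal" where
  "hausdorff_gauge s U =
     (if U = {} then 0 else if s = 0 then 1 else ennreal (diameter U powr s))"

text \<open>Boundedness is required because \<^const>\<open>diameter\<close> is unspecified on unbounded sets.\<close>

definition hausdorff_premeasure :: "real \<Rightarrow> real \<Rightarrow> 'a::metric_space set \<Rightarrow> ennreal" where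
  "hausdorff_premeasure s \<delta> A =
     (INF U \<in> {U :: nat \<Rightarrow> 'a set. A \<subseteq> (\<Union>i. U i) \<and> (\<forall>i. bounded (U i) \<and> diameter (U i) \<le> \<delta>)}.
        \<Sum>i. hausdorff_gauge s (U i))"

definition hausdorff_measure :: "real \<Rightarrow> 'a::metric_space set \<Rightarrow> ennreal" where
  "hausdorff_measure s A = (SUP \<delta> \<in> {0<..}. hausdorff_premeasure s \<delta> A)"

definition hausdorff_dim :: "'a::metric_space set \<Rightarrow> ennreal" where
  "hausdorff_dim A = Inf (ennreal ` {s. s \<ge> 0 \<and> hausdorff_measure s A = 0})"

definition F_set :: "real \<Rightarrow> real set" where
  "F_set z = {x \<in> {0<..<1} - \<rat>.
     limsup (\<lambda>n. ereal (- ln (of_int (partial_quotient x (n + 1))) / ln \<bar>x - cf_convergent x n\<bar>))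
       = ereal z}"

end

theory Submission
  imports Defs "HOL-Real_Asymp.Real_Asymp"
begin

text \<open>
  Write \<open>a\<^sub>n\<close> for the partial quotients of \<open>x\<close> and \<open>e\<^sub>n = \<bar>x - p\<^sub>n / q\<^sub>n\<bar>\<close>. As \<open>a\<^sub>n\<^sub>+\<^sub>1 q\<^sub>n\<^sup>2 e\<^sub>n\<close> always
  lies between \<open>1 / 3\<close> and \<open>1\<close> (\<open>conv_error_bounds\<close>), the ratio in question is
  \<open>1 - 2 ln q\<^sub>n / (- ln e\<^sub>n)\<close> up to an error that tends to \<open>0\<close>. It belongs to the unit interval,
  which settles \<open>z < 0\<close> and \<open>z > 1\<close>. For \<open>0 < z < 1\<close> the set \<open>F_set z\<close> consists of the irrationals
  whose exact order of approximation by rationals \<open>p / q\<close> is \<open>q\<close> to the power \<open>- 2 / (1 - z)\<close>, and for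
  \<open>z = 1\<close> of the Liouville numbers. The theorem is thus a statement of Jarnik-Besicovitch type.

  Upper bound. If the limes superior exceeds \<open>t\<close>, then \<open>x\<close> is within \<open>q\<close> to the power \<open>- 2 / (1 - t)\<close>
  of fractions \<open>p / q\<close> with \<open>q\<close> arbitrarily large. Covering by these neighbourhoods gives measure \<open>0\<close> at
  every exponent above \<open>1 - t\<close> (\<open>limsup_cf_ratio_gt_null\<close>).

  Lower bound. By Legendre's criterion a fraction very close to \<open>x\<close> is a convergent
  (\<open>close_fraction_is_convergent\<close>), so it is enough to construct points with prescribed good
  approximations. An interval of length \<open>L\<close> contains a number proportional to \<open>L Q\<^sup>2\<close> of fractions with
  denominator at most \<open>Q\<close> (\<open>many_rationals_in_interval\<close>), at mutual distances at least \<open>1 / Q\<^sup>2\<close>. Placing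
  an interval of length \<open>\<rho>\<^sub>k\<close> next to each of them, for a rapidly growing sequence \<open>Q\<^sub>k\<close>, yields a Cantor
  set. Here \<open>\<rho>\<^sub>k\<close> is \<open>Q\<^sub>k\<close> to the power \<open>- 2 / (1 - w\<^sub>k)\<close> with \<open>w\<^sub>k\<close> increasing strictly to \<open>z\<close>. Because
  \<open>w\<^sub>k < z\<close>, the number of intervals times \<open>\<rho>\<^sub>k\<close> to the power \<open>1 - z\<close> can be made to grow without bound, and
  then a mass distribution argument gives infinite measure at the exponent \<open>1 - z\<close> itself
  (\<open>cantor_scheme.hausdorff_measure_infinite\<close>). On the Cantor set the limes superior is at least \<open>z\<close>; by
  the upper bound it exceeds \<open>z\<close> only on a null set, which can be discarded. With \<open>z = 1\<close> the exponent is
  \<open>0\<close>, and the same argument shows that the counting measure is infinite.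
\<close>

section \<open>Hausdorff measure and dimension\<close>

lemma hausdorff_premeasure_le:
  assumes "A \<subseteq> (\<Union>i. U i)" "\<And>i. bounded (U i)" "\<And>i. diameter (U i) \<le> \<delta>"
  shows "hausdorff_premeasure s \<delta> A \<le> (\<Sum>i. hausdorff_gauge s (U i))"
  unfolding hausdorff_premeasure_def using assms by (intro INF_lower) auto

lemma hausdorff_premeasure_less:
  assumes "hausdorff_premeasure s \<delta> A < c"
  shows "\<exists>U :: nat \<Rightarrow> _. A \<subseteq> (\<Union>i. U i) \<and> (\<forall>i. bounded (U i) \<and> diameter (U i) \<le> \<delta>) \<and>
           (\<Sum>i. hausdorff_gauge s (U i)) < c"
  using assms by (auto simp: hausdorff_premeasure_def INF_less_iff)

lemma hausdorff_premeasure_mono: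
  assumes "A \<subseteq> B"
  shows "hausdorff_premeasure s \<delta> A \<le> hausdorff_premeasure s \<delta> B"
  unfolding hausdorff_premeasure_def using assms by (intro INF_superset_mono) auto

lemma hausdorff_measure_mono:
  assumes "A \<subseteq> B"
  shows "hausdorff_measure s A \<le> hausdorff_measure s B"
  unfolding hausdorff_measure_def
  by (intro SUP_mono') (rule hausdorff_premeasure_mono[OF assms])

lemma hausdorff_premeasure_antimono:
  assumes "\<delta> \<le> \<delta>'"
  shows "hausdorff_premeasure s \<delta>' A \<le> hausdorff_premeasure s \<delta> A"
  unfolding hausdorff_premeasure_def using assms
  by (intro INF_superset_mono) (auto intro: order_trans)

text \<open>
Near-optimal covers of the sets \<open>A i\<close>, with errors \<open>e / 2\<^sup>i\<^sup>+\<^sup>1\<close>, are merged into one sequence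
along the pairing of \<open>nat \<times> nat\<close> with \<open>nat\<close>.
\<close>

lemma hausdorff_premeasure_UN_le:
  fixes A :: "nat \<Rightarrow> 'a::metric_space set"
  shows "hausdorff_premeasure s \<delta> (\<Union>i. A i) \<le> (\<Sum>i. hausdorff_premeasure s \<delta> (A i))"
proof (rule ennreal_le_epsilon)
  fix e :: real
  assume fin: "(\<Sum>i. hausdorff_premeasure s \<delta> (A i)) < top" and e: "0 < e"
  have "\<exists>U. A i \<subseteq> (\<Union>j. U j) \<and> (\<forall>j. bounded (U j) \<and> diameter (U j) \<le> \<delta>) \<and>
      (\<Sum>j. hausdorff_gauge s (U j)) \<le> hausdorff_premeasure s \<delta> (A i) + ennreal (e * (1/2)^Suc i)" for i
  proof -
    have "hausdorff_premeasure s \<delta> (A i) \<noteq> \<infinity>"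
      using ennreal_suminf_lessD[OF fin, of i] by simp
    moreover have "ennreal (e * (1/2)^Suc i) \<noteq> 0"
      using e by (simp add: power_eq_0_iff)
    ultimately have "hausdorff_premeasure s \<delta> (A i) + 0 <
        hausdorff_premeasure s \<delta> (A i) + ennreal (e * (1/2)^Suc i)"
      unfolding ennreal_add_left_cancel_less zero_less_iff_neq_zero by blast
    then have "hausdorff_premeasure s \<delta> (A i) <
        hausdorff_premeasure s \<delta> (A i) + ennreal (e * (1/2)^Suc i)"
      unfolding add_0_right .
    from hausdorff_premeasure_less[OF this] show ?thesis
      using less_imp_le by blast
  qed
  then obtain U where U: "\<And>i. A i \<subseteq> (\<Union>j. U i j)" "\<And>i j. bounded (U i j)"
      "\<And>i j. diameter (U i j) \<le> \<delta>"
      "\<And>i. (\<Sum>j. hausdorff_gauge s (U i j)) \<le> hausdorff_premeasure s \<delta> (A i) + ennreal (e * (1/2)^Suc i)"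
    by metis
  define V where "V n = (case prod_decode n of (i, j) \<Rightarrow> U i j)" for n
  have cov: "(\<Union>i. A i) \<subseteq> (\<Union>n. V n)"
  proof
    fix x assume "x \<in> (\<Union>i. A i)"
    then obtain i j where "x \<in> U i j" using U(1) by blast
    then have "x \<in> V (prod_encode (i, j))" by (simp add: V_def)
    then show "x \<in> (\<Union>n. V n)" by blast
  qed
  have "hausdorff_premeasure s \<delta> (\<Union>i. A i) \<le> (\<Sum>n. hausdorff_gauge s (V n))"
    by (rule hausdorff_premeasure_le[OF cov]) (auto simp: V_def U split: prod.split)
  also have "\<dots> = (\<Sum>n. (\<lambda>(i, j). hausdorff_gauge s (U i j)) (prod_decode n))"
    by (simp add: V_def case_prod_unfold)
  also have "\<dots> = (\<Sum>i. \<Sum>j. hausdorff_gauge s (U i j))"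
    by (rule suminf_ennreal_2dimen) simp
  also have "\<dots> \<le> (\<Sum>i. hausdorff_premeasure s \<delta> (A i) + ennreal (e * (1/2)^Suc i))"
    by (intro suminf_le U) auto
  also have "\<dots> = (\<Sum>i. hausdorff_premeasure s \<delta> (A i)) + (\<Sum>i. ennreal (e * (1/2)^Suc i))"
    by (simp del: power_Suc add: suminf_add[symmetric])
  also have "(\<Sum>i. ennreal (e * (1/2)^Suc i)) = ennreal e"
    using sums_mult[OF power_half_series, of e] e by (intro suminf_ennreal_eq) auto
  finally show "hausdorff_premeasure s \<delta> (\<Union>i. A i) \<le>
      (\<Sum>i. hausdorff_premeasure s \<delta> (A i)) + ennreal e" .
qed

text \<open>
This lets a set of exact approximation order be measured through the larger set on which the
order is only bounded below: the excess is a countable union of null sets.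
\<close>

lemma hausdorff_measure_le_up_to_null:
  fixes N :: "nat \<Rightarrow> 'a::metric_space set"
  assumes "W \<subseteq> F \<union> (\<Union>k. N k)" and null: "\<And>k. hausdorff_measure s (N k) = 0"
  shows "hausdorff_measure s W \<le> hausdorff_measure s F"
  unfolding hausdorff_measure_def
proof (rule SUP_subset_mono[OF order_refl])
  fix \<delta> :: real
  assume \<delta>: "\<delta> \<in> {0<..}"
  have null': "hausdorff_premeasure s \<delta> (N k) = 0" for k
    using null[of k] \<delta> unfolding hausdorff_measure_def by (metis SUP_upper le_zero_eq)
  define A where "A = case_nat F N"
  have "W \<subseteq> (\<Union>i. A i)"
  proof
    fix x assume "x \<in> W"
    then have "x \<in> A 0 \<or> (\<exists>k. x \<in> A (Suc k))"
      using assms(1) by (auto simp: A_def)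
    then show "x \<in> (\<Union>i. A i)" by blast
  qed
  then have "hausdorff_premeasure s \<delta> W \<le> (\<Sum>i. hausdorff_premeasure s \<delta> (A i))"
    using hausdorff_premeasure_mono hausdorff_premeasure_UN_le order_trans by blast
  also have "\<dots> = (\<Sum>i\<in>{0}. hausdorff_premeasure s \<delta> (A i))"
    by (intro suminf_finite) (auto simp: A_def null' split: nat.split)
  finally show "hausdorff_premeasure s \<delta> W \<le> hausdorff_premeasure s \<delta> F"
    by (simp add: A_def)
qed

text \<open>
The bound on the diameter makes the powers decrease in the exponent, and it bounds them by \<open>1\<close>, the
gauge of a nonempty set at exponent \<open>0\<close>.
\<close>

lemma hausdorff_gauge_antimono:
  assumes "0 \<le> s" "s \<le> t" "bounded U" "diameter U \<le> 1"
  shows "hausdorff_gauge t U \<le> hausdorff_gauge s U"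
proof -
  have d: "0 \<le> diameter U" using assms(3) by (rule diameter_ge_0)
  show ?thesis
    using assms d powr_mono'[of s t "diameter U"] powr_le1[of t "diameter U"]
    by (auto simp: hausdorff_gauge_def simp flip: ennreal_1)
qed

lemma hausdorff_measure_antimono:
  assumes "0 \<le> s" "s \<le> t"
  shows "hausdorff_measure t A \<le> hausdorff_measure s A"
  unfolding hausdorff_measure_def
proof (rule SUP_mono)
  fix \<delta> :: real
  assume \<delta>: "\<delta> \<in> {0<..}"
  have "hausdorff_premeasure t \<delta> A \<le> hausdorff_premeasure t (min \<delta> 1) A"
    by (rule hausdorff_premeasure_antimono) simp
  also have "\<dots> \<le> hausdorff_premeasure s (min \<delta> 1) A"
    unfolding hausdorff_premeasure_def
    by (rule INF_mono) (force intro!: suminf_le hausdorff_gauge_antimono assms)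
  finally show "\<exists>\<delta>'\<in>{0<..}. hausdorff_premeasure t \<delta> A \<le> hausdorff_premeasure s \<delta>' A"
    using \<delta> by (intro bexI[of _ "min \<delta> 1"]) auto
qed

text \<open>
By monotonicity in the exponent, positive measure at \<open>d\<close> rules out null measure at every smaller
exponent.
\<close>

lemma hausdorff_dim_eqI:
  assumes "0 \<le> d" and pos: "hausdorff_measure d A > 0"
    and null: "\<And>s. s > d \<Longrightarrow> hausdorff_measure s A = 0"
  shows "hausdorff_dim A = ennreal d"
  unfolding hausdorff_dim_def
proof (rule antisym)
  show "Inf (ennreal ` {s. 0 \<le> s \<and> hausdorff_measure s A = 0}) \<le> ennreal d"
  proof (rule ennreal_le_epsilon)
    fix e :: real
    assume e: "0 < e"
    have "Inf (ennreal ` {s. 0 \<le> s \<and> hausdorff_measure s A = 0}) \<le> ennreal (d + e)"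
      by (rule Inf_lower, rule imageI) (use e assms(1) null[of "d + e"] in auto)
    then show "Inf (ennreal ` {s. 0 \<le> s \<and> hausdorff_measure s A = 0}) \<le> ennreal d + ennreal e"
      using e assms(1) by (simp add: ennreal_plus)
  qed
  show "ennreal d \<le> Inf (ennreal ` {s. 0 \<le> s \<and> hausdorff_measure s A = 0})"
  proof (rule Inf_greatest, clarify)
    fix s assume s: "0 \<le> s" "hausdorff_measure s A = 0"
    have "d \<le> s"
    proof (rule ccontr)
      assume "\<not> d \<le> s"
      then show False using hausdorff_measure_antimono[of s d A] s pos by simp
    qed
    then show "ennreal d \<le> ennreal s" by (rule ennreal_leI)
  qed
qed

section \<open>Convergents and their approximation error\<close>

text \<open>
The recursion peels off the first partial quotient, which matches the definition of
\<^const>\<open>cf_value\<close> and of the Gauss map: if \<open>x = 1 / (a + y)\<close> and \<open>p / q\<close> is the \<open>n\<close>-th convergent of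
\<open>y\<close>, then \<open>q / (a q + p)\<close> is the next convergent of \<open>x\<close>. The recurrence in the last partial
quotient, which controls the growth of the denominators, is derived from it below.
\<close>

fun conv_num :: "real \<Rightarrow> nat \<Rightarrow> nat" and conv_den :: "real \<Rightarrow> nat \<Rightarrow> nat" where
  "conv_num x 0 = 0"
| "conv_num x (Suc n) = conv_den (gauss_map x) n"
| "conv_den x 0 = 1"
| "conv_den x (Suc n) =
     nat (partial_quotient x 1) * conv_den (gauss_map x) n + conv_num (gauss_map x) n"

lemma gauss_map_maps_to:
  fixes x :: real
  assumes "x \<in> {0<..<1} - \<rat>"
  shows "gauss_map x \<in> {0<..<1} - \<rat>"
  using gauss_map_irrational assms by blast

lemma partial_quotient_nat:
  fixes x :: real
  assumes "x \<in> {0<..<1} - \<rat>"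
  shows "nat (partial_quotient x n) \<ge> 1" "real (nat (partial_quotient x n)) = of_int (partial_quotient x n)"
  using partial_quotient_ge_1[OF assms, of n] by auto

lemma conv_den_pos:
  fixes x :: real
  assumes "x \<in> {0<..<1} - \<rat>"
  shows "conv_den x n \<ge> 1"
  using assms
proof (induction n arbitrary: x)
  case (Suc n)
  have "1 * 1 \<le> nat (partial_quotient x 1) * conv_den (gauss_map x) n"
    by (intro mult_le_mono partial_quotient_nat(1) Suc gauss_map_maps_to)
  then have "1 \<le> nat (partial_quotient x 1) * conv_den (gauss_map x) n" by simp
  then show ?case unfolding conv_den.simps by (rule trans_le_add1)
qed simp

lemma cf_convergent_eq_num_den:
  fixes x :: real
  assumes "x \<in> {0<..<1} - \<rat>"
  shows "cf_convergent x n = real (conv_num x n) / real (conv_den x n)"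
  using assms
proof (induction n arbitrary: x)
  case 0
  then show ?case by (simp add: cf_convergent_def)
next
  case (Suc n)
  note y = gauss_map_maps_to[OF Suc.prems]
  have "conv_den (gauss_map x) n \<ge> 1" by (rule conv_den_pos[OF y])
  then have "cf_convergent (gauss_map x) n * conv_den (gauss_map x) n = conv_num (gauss_map x) n"
    by (simp add: Suc.IH[OF y])
  then have "real (conv_den x (Suc n)) =
      conv_den (gauss_map x) n * (of_int (partial_quotient x 1) + cf_convergent (gauss_map x) n)"
    using partial_quotient_nat(2)[OF Suc.prems, of 1] by (simp add: algebra_simps)
  moreover have "real (conv_den (gauss_map x) n) > 0"
    using \<open>conv_den (gauss_map x) n \<ge> 1\<close> by simp
  ultimately show ?case
    by (simp add: cf_convergent_Suc del: conv_den.simps(2))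
qed

lemma conv_num_le_den:
  fixes x :: real
  assumes "x \<in> {0<..<1} - \<rat>"
  shows "conv_num x n \<le> conv_den x n"
  using cf_convergent_range[OF assms, of n] conv_den_pos[OF assms, of n]
  by (simp add: cf_convergent_eq_num_den[OF assms] divide_simps)

lemma conv_recurrence:
  "conv_num x (Suc (Suc n)) =
     nat (partial_quotient x (Suc (Suc n))) * conv_num x (Suc n) + conv_num x n"
  "conv_den x (Suc (Suc n)) =
     nat (partial_quotient x (Suc (Suc n))) * conv_den x (Suc n) + conv_den x n"
proof (induction n arbitrary: x)
  case 0
  {
    case 1
    show ?case by (simp add: partial_quotient_gauss_map numeral_2_eq_2)
  next
    case 2
    show ?case by (simp add: partial_quotient_gauss_map numeral_2_eq_2)
  }
next
  case (Suc n)
  have pq: "partial_quotient (gauss_map x) (Suc (Suc n)) = partial_quotient x (Suc (Suc (Suc n)))" for x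
    by (rule partial_quotient_gauss_map) simp
  {
    case 1
    show ?case
      unfolding conv_num.simps(2)[of x] Suc(2)[of "gauss_map x"] pq by (rule refl)
  next
    case 2
    show ?case
      unfolding conv_den.simps(2)[of x] Suc[of "gauss_map x"] conv_num.simps(2)[of x] pq
      by (simp add: algebra_simps del: conv_num.simps conv_den.simps)
  }
qed

lemma conv_den_Suc_bounds:
  fixes x :: real
  assumes "x \<in> {0<..<1} - \<rat>"
  shows "nat (partial_quotient x (Suc n)) * conv_den x n \<le> conv_den x (Suc n)"
    and "conv_den x (Suc n) \<le> (nat (partial_quotient x (Suc n)) + 1) * conv_den x n"
    and "n \<ge> 1 \<Longrightarrow> conv_den x n < conv_den x (Suc n)"
proof -
  have mono: "conv_den x k \<le> conv_den x (Suc k)" for k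
  proof (cases k)
    case 0
    then show ?thesis using partial_quotient_nat(1)[OF assms, of 1] by simp
  next
    case (Suc m)
    have "1 * conv_den x k \<le> nat (partial_quotient x (Suc k)) * conv_den x k"
      by (intro mult_le_mono partial_quotient_nat(1)[OF assms] order_refl)
    then show ?thesis unfolding Suc conv_recurrence(2) by linarith
  qed
  show "nat (partial_quotient x (Suc n)) * conv_den x n \<le> conv_den x (Suc n)"
  proof (cases n)
    case (Suc m)
    then show ?thesis by (simp add: conv_recurrence(2) del: conv_den.simps(2))
  qed simp
  show "conv_den x (Suc n) \<le> (nat (partial_quotient x (Suc n)) + 1) * conv_den x n"
  proof (cases n)
    case (Suc m)
    then show ?thesis using mono[of m] by (simp add: conv_recurrence(2) del: conv_den.simps(2))
  qed simp
  show "conv_den x n < conv_den x (Suc n)" if "n \<ge> 1"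
  proof -
    from that obtain m where n: "n = Suc m" by (cases n) auto
    have "1 * conv_den x n \<le> nat (partial_quotient x (Suc n)) * conv_den x n"
      by (intro mult_le_mono partial_quotient_nat(1)[OF assms] order_refl)
    then show ?thesis
      using conv_den_pos[OF assms, of m] unfolding n conv_recurrence(2) by linarith
  qed
qed

lemma conv_den_ge:
  fixes x :: real
  assumes "x \<in> {0<..<1} - \<rat>"
  shows "n \<le> conv_den x n"
proof (induction n)
  case (Suc n)
  then show ?case
    using conv_den_Suc_bounds(3)[OF assms, of n] conv_den_pos[OF assms, of "Suc n"]
    by (cases n) auto
qed simp

lemma gauss_map_reciprocal:
  fixes x :: real
  assumes "x \<in> {0<..<1} - \<rat>"
  shows "x * (of_int (partial_quotient x 1) + gauss_map x) = 1"
proof -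
  have "real_of_int (partial_quotient x 1) + gauss_map x > 0"
    using partial_quotient_ge_1[OF assms, of 1] gauss_map_maps_to[OF assms] by auto
  then show ?thesis by (subst (1) gauss_map_expand) simp
qed

text \<open>
With \<open>w = T\<^sup>n\<^sup>+\<^sup>1 x\<close> for the Gauss map \<open>T\<close>, this is \<open>x = (p\<^sub>n\<^sub>+\<^sub>1 + p\<^sub>n w) / (q\<^sub>n\<^sub>+\<^sub>1 + q\<^sub>n w)\<close>,
the expansion of \<open>x\<close> with its tail kept as one real variable.
\<close>

lemma conv_moebius:
  fixes x :: real
  assumes "x \<in> {0<..<1} - \<rat>"
  shows "x * (conv_den x (Suc n) + conv_den x n * (gauss_map ^^ Suc n) x) =
           conv_num x (Suc n) + conv_num x n * (gauss_map ^^ Suc n) x"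
  using assms
proof (induction n arbitrary: x)
  case 0
  then show ?case
    using gauss_map_reciprocal[OF 0] partial_quotient_nat(2)[OF 0, of 1] by (simp add: algebra_simps)
next
  case (Suc n)
  define y where "y = gauss_map x"
  define w where "w = (gauss_map ^^ Suc (Suc n)) x"
  define a where "a = real_of_int (partial_quotient x 1)"
  have y: "y \<in> {0<..<1} - \<rat>"
    unfolding y_def by (rule gauss_map_maps_to[OF Suc.prems])
  have w: "(gauss_map ^^ Suc n) y = w" by (simp add: w_def y_def funpow_swap1)
  have IH: "y * (conv_den y (Suc n) + conv_den y n * w) = conv_num y (Suc n) + conv_num y n * w"
    using Suc.IH[OF y] unfolding w .
  have "real (conv_den x (Suc (Suc n))) + conv_den x (Suc n) * w =
      a * (conv_den y (Suc n) + conv_den y n * w) + (conv_num y (Suc n) + conv_num y n * w)"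
    using partial_quotient_nat(2)[OF Suc.prems, of 1]
    by (simp add: a_def y_def algebra_simps)
  also have "\<dots> = (a + y) * (conv_den y (Suc n) + conv_den y n * w)"
    unfolding IH[symmetric] by (simp add: algebra_simps)
  finally have "x * (real (conv_den x (Suc (Suc n))) + conv_den x (Suc n) * w) =
      (x * (a + y)) * (conv_den y (Suc n) + conv_den y n * w)"
    by simp
  also have "x * (a + y) = 1"
    using gauss_map_reciprocal[OF Suc.prems] by (simp add: a_def y_def)
  finally show ?case
    by (simp add: w_def[symmetric] y_def[symmetric] del: conv_den.simps(2) funpow.simps)
qed

text \<open>
The exact form of the approximation error. Passing from \<open>y = T x\<close> to \<open>x\<close> multiplies
\<open>\<bar>q\<^sub>n y - p\<^sub>n\<bar>\<close> by \<open>x\<close> and the second factor by \<open>a\<^sub>1 + y = 1 / x\<close>, so that the product stays \<open>1\<close>.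
\<close>

lemma conv_error_identity:
  fixes x :: real
  assumes "x \<in> {0<..<1} - \<rat>"
  shows "\<bar>conv_den x n * x - conv_num x n\<bar> *
           (conv_den x (Suc n) + conv_den x n * (gauss_map ^^ Suc n) x) = 1"
  using assms
proof (induction n arbitrary: x)
  case 0
  then show ?case
    using gauss_map_reciprocal[OF 0] partial_quotient_nat(2)[OF 0, of 1] by simp
next
  case (Suc n)
  define y where "y = gauss_map x"
  define w where "w = (gauss_map ^^ Suc (Suc n)) x"
  define a where "a = real_of_int (partial_quotient x 1)"
  have y: "y \<in> {0<..<1} - \<rat>"
    unfolding y_def by (rule gauss_map_maps_to[OF Suc.prems])
  have w: "(gauss_map ^^ Suc n) y = w" by (simp add: w_def y_def funpow_swap1)
  have xay: "x * (a + y) = 1" and x: "x > 0"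
    using gauss_map_reciprocal[OF Suc.prems] Suc.prems by (simp_all add: a_def y_def)
  have "real (conv_den x (Suc (Suc n))) + conv_den x (Suc n) * w =
      a * (conv_den y (Suc n) + conv_den y n * w) + (conv_num y (Suc n) + conv_num y n * w)"
    using partial_quotient_nat(2)[OF Suc.prems, of 1]
    by (simp add: a_def y_def algebra_simps)
  also have "\<dots> = (a + y) * (conv_den y (Suc n) + conv_den y n * w)"
    using conv_moebius[OF y, of n, unfolded w] by (simp add: algebra_simps)
  finally have den: "real (conv_den x (Suc (Suc n))) + conv_den x (Suc n) * w =
      (a + y) * (conv_den y (Suc n) + conv_den y n * w)" .
  have "conv_den x (Suc n) * x - conv_num x (Suc n) =
      x * a * conv_den y n + x * conv_num y n - conv_den y n"
    using partial_quotient_nat(2)[OF Suc.prems, of 1] by (simp add: a_def y_def algebra_simps)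
  also have "\<dots> = x * a * conv_den y n + x * conv_num y n - (x * (a + y)) * conv_den y n"
    unfolding xay by simp
  also have "\<dots> = - x * (conv_den y n * y - conv_num y n)"
    by (simp add: algebra_simps)
  finally have num: "\<bar>conv_den x (Suc n) * x - conv_num x (Suc n)\<bar> =
      x * \<bar>conv_den y n * y - conv_num y n\<bar>"
    using x by (simp add: abs_mult)
  have "\<bar>conv_den x (Suc n) * x - conv_num x (Suc n)\<bar> *
      (conv_den x (Suc (Suc n)) + conv_den x (Suc n) * w) =
      (x * (a + y)) * (\<bar>conv_den y n * y - conv_num y n\<bar> * (conv_den y (Suc n) + conv_den y n * w))"
    unfolding num den by (simp add: mult_ac)
  also have "\<dots> = 1"
    using Suc.IH[OF y] unfolding w xay by simp
  finally show ?case unfolding w_def .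
qed

lemma cf_convergent_neq:
  fixes x :: real
  assumes "x \<in> {0<..<1} - \<rat>"
  shows "x \<noteq> cf_convergent x n"
proof
  assume "x = cf_convergent x n"
  then have "x = real (conv_num x n) / real (conv_den x n)"
    unfolding cf_convergent_eq_num_den[OF assms] .
  moreover have "real (conv_num x n) / real (conv_den x n) \<in> \<rat>" by simp
  ultimately show False using assms by simp
qed

lemma conv_error_scaled:
  fixes x :: real
  assumes "x \<in> {0<..<1} - \<rat>"
  shows "\<bar>conv_den x n * x - conv_num x n\<bar> = conv_den x n * \<bar>x - cf_convergent x n\<bar>"
proof -
  have q: "real (conv_den x n) > 0" using conv_den_pos[OF assms, of n] by simp
  have "conv_den x n * x - conv_num x n = conv_den x n * (x - cf_convergent x n)"
    using q by (simp add: cf_convergent_eq_num_den[OF assms] field_simps)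
  then show ?thesis by (simp add: abs_mult)
qed

text \<open>
The last two bounds say that \<open>a\<^sub>n\<^sub>+\<^sub>1 q\<^sub>n\<^sup>2 \<bar>x - p\<^sub>n / q\<^sub>n\<bar>\<close> lies between \<open>1 / 3\<close> and \<open>1\<close>. This is what
translates partial quotients into approximation exponents.
\<close>

lemma conv_error_bounds:
  fixes x :: real
  assumes "x \<in> {0<..<1} - \<rat>"
  defines "a \<equiv> \<lambda>n. real_of_int (partial_quotient x (Suc n))" and "q \<equiv> \<lambda>n. real (conv_den x n)"
    and "e \<equiv> \<lambda>n. \<bar>x - cf_convergent x n\<bar>"
  shows "q n * e n * q (Suc n) < 1"
    and "a n * (q n)\<^sup>2 * e n \<le> 1" and "1 \<le> 3 * a n * (q n)\<^sup>2 * e n"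
proof -
  define w where "w = (gauss_map ^^ Suc n) x"
  have w: "0 < w" "w < 1" using gauss_map_iterate[OF assms(1), of "Suc n"] by (auto simp: w_def)
  have q: "q n \<ge> 1" using conv_den_pos[OF assms(1), of n] by (simp add: q_def)
  have e: "e n > 0" using cf_convergent_neq[OF assms(1), of n] by (simp add: e_def)
  have a: "a n \<ge> 1" using partial_quotient_ge_1[OF assms(1), of "Suc n"] by (simp add: a_def)
  have id: "q n * e n * (q (Suc n) + q n * w) = 1"
    using conv_error_identity[OF assms(1), of n] unfolding conv_error_scaled[OF assms(1)]
    by (simp add: q_def e_def w_def)
  have qe: "q n * e n > 0" and qw: "q n * w > 0" using q e w by simp_all
  have "q n * e n * q (Suc n) < q n * e n * (q (Suc n) + q n * w)"
    using qe qw by (intro mult_strict_left_mono) auto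
  then show 1: "q n * e n * q (Suc n) < 1" using id by simp
  have lo: "a n * q n \<le> q (Suc n)"
    using conv_den_Suc_bounds(1)[OF assms(1), of n] partial_quotient_nat(2)[OF assms(1), of "Suc n"]
    unfolding a_def q_def by (metis of_nat_le_iff of_nat_mult)
  have hi: "q (Suc n) \<le> (a n + 1) * q n"
    using conv_den_Suc_bounds(2)[OF assms(1), of n] partial_quotient_nat(2)[OF assms(1), of "Suc n"]
    unfolding a_def q_def by (metis of_nat_1 of_nat_add of_nat_le_iff of_nat_mult)
  have "q n * e n * (a n * q n) \<le> q n * e n * q (Suc n)"
    using lo qe by (intro mult_left_mono) auto
  then show "a n * (q n)\<^sup>2 * e n \<le> 1" using 1 by (simp add: power2_eq_square mult_ac)
  have "q n * w \<le> q n" using q w by simp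
  moreover have "q n \<le> a n * q n" using a q by simp
  ultimately have "q (Suc n) + q n * w \<le> 3 * (a n * q n)" using hi by (simp add: algebra_simps)
  then have "q n * e n * (q (Suc n) + q n * w) \<le> q n * e n * (3 * (a n * q n))"
    using qe by (intro mult_left_mono) auto
  then show "1 \<le> 3 * a n * (q n)\<^sup>2 * e n" unfolding id by (simp add: power2_eq_square mult_ac)
qed

text \<open>
A form of Legendre's criterion. Let \<open>n\<close> be the last index with \<open>q\<^sub>n \<le> 2 b\<close>. If \<open>p / b\<close> differed
from \<open>p\<^sub>n / q\<^sub>n\<close>, the nonzero integer \<open>p q\<^sub>n - p\<^sub>n b\<close> would have absolute value at least \<open>1\<close>; but it is
\<open>q\<^sub>n (p - b x) + b (q\<^sub>n x - p\<^sub>n)\<close>, and both summands are smaller than \<open>1 / 2\<close>, the first because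
\<open>p / b\<close> is close to \<open>x\<close> and the second because \<open>q\<^sub>n\<^sub>+\<^sub>1 > 2 b\<close>.
\<close>

lemma close_fraction_is_convergent:
  fixes p :: int and b :: nat
  assumes x: "x \<in> {0<..<1} - \<rat>" and b: "b \<ge> 1" and close: "\<bar>x - p / b\<bar> < 1 / (4 * b\<^sup>2)"
  shows "\<exists>n. conv_den x n \<le> 2 * b \<and> cf_convergent x n = p / b"
proof -
  define n where "n = (GREATEST n. conv_den x n \<le> 2 * b)"
  have bound: "\<And>n. conv_den x n \<le> 2 * b \<Longrightarrow> n \<le> 2 * b"
    using conv_den_ge[OF x] order_trans by blast
  have 0: "conv_den x 0 \<le> 2 * b" using b by simp
  have n: "conv_den x n \<le> 2 * b"
    unfolding n_def using GreatestI_nat[of "\<lambda>n. conv_den x n \<le> 2 * b", OF 0] bound by blast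
  have Suc_n: "conv_den x (Suc n) > 2 * b"
  proof (rule ccontr)
    assume "\<not> ?thesis"
    then have "Suc n \<le> n"
      unfolding n_def using Greatest_le_nat[of "\<lambda>n. conv_den x n \<le> 2 * b" _ "2 * b"] bound
      by (meson not_less)
    then show False by simp
  qed
  define q u where "q = real (conv_den x n)" and "u = real (conv_num x n)"
  have q: "q \<ge> 1" using conv_den_pos[OF x, of n] by (simp add: q_def)
  have "p * conv_den x n = conv_num x n * int b"
  proof (rule ccontr)
    assume "p * conv_den x n \<noteq> conv_num x n * int b"
    then have "1 \<le> \<bar>p * conv_den x n - conv_num x n * int b\<bar>" by simp
    then have "1 \<le> \<bar>real_of_int (p * conv_den x n - conv_num x n * int b)\<bar>" by linarith
    then have "1 \<le> \<bar>p * q - u * b\<bar>" by (simp add: q_def u_def)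
    also have "p * q - u * b = q * (p - b * x) + b * (q * x - u)" by (simp add: algebra_simps)
    also have "\<bar>\<dots>\<bar> \<le> q * \<bar>p - b * x\<bar> + b * \<bar>q * x - u\<bar>"
      using abs_triangle_ineq[of "q * (p - b * x)" "b * (q * x - u)"] q by (simp add: abs_mult)
    finally have 1: "1 \<le> q * \<bar>p - b * x\<bar> + b * \<bar>q * x - u\<bar>" .
    have "\<bar>p - b * x\<bar> = b * \<bar>x - p / b\<bar>"
    proof -
      have "p - b * x = - (b * (x - p / b))" using b by (simp add: field_simps)
      then show ?thesis by (simp only: abs_minus_cancel abs_mult abs_of_nat)
    qed
    also have "\<dots> < b * (1 / (4 * b\<^sup>2))" using close b by (intro mult_strict_left_mono) auto
    also have "\<dots> = 1 / (4 * b)" using b by (simp add: power2_eq_square)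
    finally have "q * \<bar>p - b * x\<bar> < q * (1 / (4 * b))" using q by (intro mult_strict_left_mono) auto
    also have "\<dots> \<le> 2 * b * (1 / (4 * b))"
      using n by (intro mult_right_mono) (auto simp: q_def simp flip: of_nat_mult)
    also have "\<dots> = 1 / 2" using b by simp
    finally have 2: "q * \<bar>p - b * x\<bar> < 1 / 2" .
    define D where "D = \<bar>q * x - u\<bar>"
    have "D * conv_den x (Suc n) < 1"
      using conv_error_bounds(1)[OF x, of n] conv_error_scaled[OF x, of n]
      by (simp add: D_def q_def u_def)
    moreover have "D * (2 * b) \<le> D * conv_den x (Suc n)"
      using Suc_n by (intro mult_left_mono) (auto simp: D_def simp flip: of_nat_mult)
    ultimately have "D * (2 * b) < 1" by linarith
    then have "b * D < 1 / 2" by (simp add: mult_ac)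
    then show False using 1 2 unfolding D_def by linarith
  qed
  then have "real_of_int p * q = u * b"
    unfolding q_def u_def by (metis of_int_mult of_int_of_nat_eq)
  then have "u / q = p / b" using q b by (simp add: field_simps)
  then have "cf_convergent x n = p / b"
    by (simp add: cf_convergent_eq_num_den[OF x] q_def u_def)
  with n show ?thesis by blast
qed

section \<open>Partial quotients measured against the approximation error\<close>

definition cf_ratio :: "real \<Rightarrow> nat \<Rightarrow> real" where
  "cf_ratio x n = - ln (of_int (partial_quotient x (n + 1))) / ln \<bar>x - cf_convergent x n\<bar>"

lemma conv_error_less_1:
  fixes x :: real
  assumes "x \<in> {0<..<1} - \<rat>"
  shows "\<bar>x - cf_convergent x n\<bar> < 1"
  using cf_convergent_range[OF assms, of n] assms by auto

text \<open>
Up to a bounded term in the numerator the ratio is \<open>1 - 2 ln q\<^sub>n / (- ln \<bar>x - p\<^sub>n / q\<^sub>n\<bar>)\<close>. Hence the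
ratio exceeds \<open>t\<close> roughly when \<open>\<bar>x - p\<^sub>n / q\<^sub>n\<bar>\<close> is below \<open>q\<^sub>n\<close> to the power \<open>- 2 / (1 - t)\<close>.
\<close>

lemma cf_ratio_bounds:
  assumes x: "x \<in> {0<..<1} - \<rat>"
  shows "0 \<le> cf_ratio x n" "cf_ratio x n \<le> 1"
    and "cf_ratio x n \<ge> 1 - (2 * ln (conv_den x n) + ln 3) / (- ln \<bar>x - cf_convergent x n\<bar>)"
    and "cf_ratio x n \<le> 1 - 2 * ln (conv_den x n) / (- ln \<bar>x - cf_convergent x n\<bar>)"
proof -
  define a e q where "a = real_of_int (partial_quotient x (n + 1))"
    and "e = \<bar>x - cf_convergent x n\<bar>" and "q = real (conv_den x n)"
  have a: "a \<ge> 1" using partial_quotient_ge_1[OF x, of "n + 1"] by (simp add: a_def)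
  have q: "q \<ge> 1" using conv_den_pos[OF x, of n] by (simp add: q_def)
  have e: "0 < e" "e < 1"
    using cf_convergent_neq[OF x, of n] conv_error_less_1[OF x, of n] by (auto simp: e_def)
  define \<Lambda> where "\<Lambda> = - ln e"
  have \<Lambda>: "\<Lambda> > 0" using e by (simp add: \<Lambda>_def)
  have ratio: "cf_ratio x n = ln a / \<Lambda>"
    by (simp add: cf_ratio_def a_def \<Lambda>_def e_def)
  show "0 \<le> cf_ratio x n" using a \<Lambda> by (simp add: ratio)
  have "a * q\<^sup>2 * e \<le> 1" using conv_error_bounds(2)[OF x, of n] by (simp add: a_def q_def e_def)
  then have "ln (a * q\<^sup>2 * e) \<le> 0" using a q e by (subst ln_le_zero_iff) auto
  then have up: "ln a + 2 * ln q \<le> \<Lambda>"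
    using a q e by (simp add: \<Lambda>_def ln_mult ln_realpow)
  then show 4: "cf_ratio x n \<le> 1 - 2 * ln (conv_den x n) / (- ln \<bar>x - cf_convergent x n\<bar>)"
    using \<Lambda> unfolding ratio e_def[symmetric] q_def[symmetric] \<Lambda>_def[symmetric] by (simp add: field_simps)
  have "ln q \<ge> 0" using q by simp
  then show "cf_ratio x n \<le> 1" using up \<Lambda> by (simp add: ratio)
  have "1 \<le> 3 * a * q\<^sup>2 * e" using conv_error_bounds(3)[OF x, of n] by (simp add: a_def q_def e_def)
  then have "0 \<le> ln (3 * a * q\<^sup>2 * e)" by simp
  then have "\<Lambda> \<le> ln 3 + ln a + 2 * ln q"
    using a q e by (simp add: \<Lambda>_def ln_mult ln_realpow)
  then show "cf_ratio x n \<ge> 1 - (2 * ln (conv_den x n) + ln 3) / (- ln \<bar>x - cf_convergent x n\<bar>)"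
    using \<Lambda> unfolding ratio e_def[symmetric] q_def[symmetric] \<Lambda>_def[symmetric]
    by (simp add: divide_simps)
qed

lemma F_set_eq:
  "F_set z = {x \<in> {0<..<1} - \<rat>. limsup (\<lambda>n. ereal (cf_ratio x n)) = ereal z}"
  by (simp add: F_set_def cf_ratio_def)

lemma limsup_cf_ratio_range:
  fixes x :: real
  assumes "x \<in> {0<..<1} - \<rat>"
  shows "0 \<le> limsup (\<lambda>n. ereal (cf_ratio x n))" "limsup (\<lambda>n. ereal (cf_ratio x n)) \<le> 1"
proof -
  have "liminf (\<lambda>n. ereal (cf_ratio x n)) \<le> limsup (\<lambda>n. ereal (cf_ratio x n))"
    by (rule Liminf_le_Limsup) simp
  moreover have "0 \<le> liminf (\<lambda>n. ereal (cf_ratio x n))"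
    by (rule Liminf_bounded) (simp add: cf_ratio_bounds[OF assms] zero_ereal_def)
  ultimately show "0 \<le> limsup (\<lambda>n. ereal (cf_ratio x n))" by (rule order_trans[rotated])
  show "limsup (\<lambda>n. ereal (cf_ratio x n)) \<le> 1"
    by (rule Limsup_bounded) (simp add: cf_ratio_bounds[OF assms] one_ereal_def)
qed

lemma F_set_empty:
  assumes "z \<notin> {0..1}"
  shows "F_set z = {}"
proof -
  have "z \<in> {0..1}" if "x \<in> F_set z" for x
    using that limsup_cf_ratio_range[of x] by (simp add: F_set_eq zero_ereal_def one_ereal_def)
  then show ?thesis using assms by blast
qed

section \<open>Null sets of well approximable numbers\<close>

lemma hausdorff_measure_eq_0I:
  assumes "\<And>\<delta> \<epsilon>. 0 < \<delta> \<Longrightarrow> 0 < \<epsilon> \<Longrightarrow> hausdorff_premeasure s \<delta> A \<le> ennreal \<epsilon>"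
  shows "hausdorff_measure s A = 0"
proof -
  have "hausdorff_premeasure s \<delta> A \<le> 0" if "\<delta> \<in> {0<..}" for \<delta>
    by (rule ennreal_le_epsilon) (use that assms[of \<delta>] in auto)
  then have "hausdorff_measure s A \<le> 0"
    unfolding hausdorff_measure_def by (intro SUP_least)
  then show ?thesis by simp
qed

lemma hausdorff_measure_empty: "hausdorff_measure s {} = 0"
proof (rule hausdorff_measure_eq_0I)
  fix \<delta> \<epsilon> :: real
  assume "0 < \<delta>" "0 < \<epsilon>"
  have "hausdorff_premeasure s \<delta> ({} :: 'a set) \<le> (\<Sum>i. hausdorff_gauge s ({} :: 'a set))"
    using hausdorff_premeasure_le[of "{}" "\<lambda>_. {}" \<delta> s] \<open>0 < \<delta>\<close> by simp
  then show "hausdorff_premeasure s \<delta> ({} :: 'a set) \<le> ennreal \<epsilon>"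
    by (simp add: hausdorff_gauge_def)
qed

text \<open>
The fractions with denominator \<open>q\<close> contribute \<open>q + 1\<close> balls of diameter \<open>2 q\<^sup>-\<^sup>\<beta>\<close>, hence about
\<open>q\<^sup>1\<^sup>-\<^sup>\<beta>\<^sup>s\<close> to the sum. The hypothesis on \<open>\<beta> s\<close> makes this summable, and the balls with
denominators beyond any \<open>Q\<close> still cover.
\<close>

lemma well_approximable_null:
  fixes \<beta> s :: real
  assumes "0 < \<beta>" "0 < s" and \<beta>s: "2 < \<beta> * s"
  shows "hausdorff_measure s
           {x :: real. \<forall>Q::nat. \<exists>q\<ge>Q. \<exists>p\<le>q. \<bar>x - real p / real q\<bar> \<le> real q powr - \<beta>} = 0"
    (is "hausdorff_measure s ?A = 0")
proof (rule hausdorff_measure_eq_0I)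
  fix \<delta> \<epsilon> :: real
  assume \<delta>: "0 < \<delta>" and \<epsilon>: "0 < \<epsilon>"
  define r where "r q = real q powr - \<beta>" for q :: nat
  define a where "a q = real (q + 1) * (2 * r q) powr s" for q :: nat
  have "summable (\<lambda>q. (2 * 2 powr s) * real q powr (1 - \<beta> * s))"
    using \<beta>s by (intro summable_mult) (simp add: summable_real_powr_iff)
  moreover have "norm (a q) \<le> (2 * 2 powr s) * real q powr (1 - \<beta> * s)" if "q \<ge> 1" for q
  proof -
    have "a q = real (q + 1) * (2 powr s * real q powr (- (\<beta> * s)))"
      by (simp add: a_def r_def powr_mult powr_powr)
    also have "\<dots> \<le> (2 * real q) * (2 powr s * real q powr (- (\<beta> * s)))"
      using that by (intro mult_right_mono) auto
    also have "\<dots> = (2 * 2 powr s) * (real q powr 1 * real q powr (- (\<beta> * s)))"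
      using that by simp
    also have "real q powr 1 * real q powr (- (\<beta> * s)) = real q powr (1 - \<beta> * s)"
      unfolding powr_add[symmetric] by simp
    finally show ?thesis by (simp add: a_def)
  qed
  ultimately have a: "summable a"
    by (rule summable_comparison_test'[where N = 1])
  have a0: "a q \<ge> 0" for q by (simp add: a_def)
  obtain Q1 where Q1: "\<And>n. n \<ge> Q1 \<Longrightarrow> norm (\<Sum>i. a (i + n)) < \<epsilon>"
    using suminf_exist_split[OF \<epsilon> a] by blast
  have "(\<lambda>q. 2 * real q powr - \<beta>) \<longlonglongrightarrow> 2 * 0"
    using assms by (intro tendsto_mult tendsto_const tendsto_neg_powr filterlim_real_sequentially) auto
  then have "eventually (\<lambda>q. 2 * real q powr - \<beta> < \<delta>) sequentially"
    using \<delta> by (intro order_tendstoD(2)[of _ "2 * 0"]) auto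
  then obtain Q2 where Q2: "\<And>q. q \<ge> Q2 \<Longrightarrow> 2 * real q powr - \<beta> < \<delta>"
    unfolding eventually_sequentially by blast
  define Q where "Q = max Q1 Q2"
  define B where "B i p = (if p \<le> i + Q then cball (real p / real (i + Q)) (r (i + Q)) else {})" for i p
  \<comment> \<open>The cover is indexed by pairs: \<open>i + Q\<close> is the denominator, and numerators beyond it get the
    empty set, whose gauge is \<open>0\<close>.\<close>
  define U where "U n = (case prod_decode n of (i, p) \<Rightarrow> B i p)" for n
  have r0: "r q \<ge> 0" for q by (simp add: r_def)
  have "2 * r (i + Q) \<le> \<delta>" for i
    using Q2[of "i + Q"] by (simp add: Q_def r_def less_imp_le)
  then have diam: "bounded (B i p)" "diameter (B i p) \<le> \<delta>" for i p
    using \<delta> r0[of "i + Q"] by (auto simp: B_def)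
  have "?A \<subseteq> (\<Union>n. U n)"
  proof
    fix x assume "x \<in> ?A"
    then obtain q p where qp: "q \<ge> Q" "p \<le> q" "\<bar>x - real p / real q\<bar> \<le> r q"
      unfolding r_def by blast
    then have "x \<in> B (q - Q) p"
      by (simp add: B_def dist_real_def abs_minus_commute)
    then have "x \<in> U (prod_encode (q - Q, p))" by (simp add: U_def)
    then show "x \<in> (\<Union>n. U n)" by blast
  qed
  then have "hausdorff_premeasure s \<delta> ?A \<le> (\<Sum>n. hausdorff_gauge s (U n))"
    by (rule hausdorff_premeasure_le) (auto simp: U_def diam split: prod.split)
  also have "\<dots> = (\<Sum>n. (\<lambda>(i, p). hausdorff_gauge s (B i p)) (prod_decode n))"
    by (simp add: U_def case_prod_unfold)
  also have "\<dots> = (\<Sum>i. \<Sum>p. hausdorff_gauge s (B i p))"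
    by (rule suminf_ennreal_2dimen) simp
  also have "\<dots> \<le> (\<Sum>i. ennreal (a (i + Q)))"
  proof (intro suminf_le)
    fix i
    have "(\<Sum>p. hausdorff_gauge s (B i p)) = (\<Sum>p\<le>i + Q. hausdorff_gauge s (B i p))"
      by (intro suminf_finite) (auto simp: B_def hausdorff_gauge_def)
    also have "\<dots> \<le> (\<Sum>p\<le>i + Q. ennreal ((2 * r (i + Q)) powr s))"
      using assms(2) r0[of "i + Q"] by (intro sum_mono) (auto simp: B_def hausdorff_gauge_def)
    also have "\<dots> = ennreal (\<Sum>p\<le>i + Q. (2 * r (i + Q)) powr s)"
      by (rule sum_ennreal) simp
    also have "(\<Sum>p\<le>i + Q. (2 * r (i + Q)) powr s) = a (i + Q)"
      by (simp add: a_def)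
    finally show "(\<Sum>p. hausdorff_gauge s (B i p)) \<le> ennreal (a (i + Q))" .
  qed auto
  also have "\<dots> = ennreal (\<Sum>i. a (i + Q))"
    using a by (intro suminf_ennreal2 a0) (simp add: summable_iff_shift)
  also have "\<dots> \<le> ennreal \<epsilon>"
    using Q1[of Q] by (intro ennreal_leI) (simp add: Q_def)
  finally show "hausdorff_premeasure s \<delta> ?A \<le> ennreal \<epsilon>" .
qed

text \<open>
For \<open>t < 1\<close> a ratio above \<open>t\<close> puts \<open>x\<close> within \<open>q\<^sup>-\<^sup>\<beta>\<close> of a convergent with denominator \<open>q\<close>, where
\<open>\<beta> = 2 / (1 - t)\<close>, and \<open>\<beta> s > 2\<close> is the hypothesis on \<open>s\<close>. For \<open>t \<ge> 1\<close> the set is empty.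
\<close>

lemma limsup_cf_ratio_gt_null:
  fixes s t :: real
  assumes "0 < t" "1 - t < s"
  shows "hausdorff_measure s {x \<in> {0<..<1} - \<rat>. ereal t < limsup (\<lambda>n. ereal (cf_ratio x n))} = 0"
    (is "hausdorff_measure s ?E = 0")
proof (cases "t < 1")
  case False
  then have "?E = {}"
    using limsup_cf_ratio_range(2) by (fastforce simp: one_ereal_def dest: order.strict_trans2)
  then show ?thesis by (simp only: hausdorff_measure_empty)
next
  case True
  define \<beta> where "\<beta> = 2 / (1 - t)"
  let ?A = "{x :: real. \<forall>Q::nat. \<exists>q\<ge>Q. \<exists>p\<le>q. \<bar>x - real p / real q\<bar> \<le> real q powr - \<beta>}"
  have \<beta>: "0 < \<beta>" "0 < s" "2 < \<beta> * s"
    using True assms by (simp_all add: \<beta>_def field_simps)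
  have "?E \<subseteq> ?A"
  proof safe
    fix x :: real and Q :: nat
    assume x: "x \<in> {0<..<1}" "x \<notin> \<rat>" and gt: "ereal t < limsup (\<lambda>n. ereal (cf_ratio x n))"
    then have x': "x \<in> {0<..<1} - \<rat>" by simp
    have "\<not> (\<forall>\<^sub>F n in sequentially. ereal (cf_ratio x n) \<le> ereal t)"
      using gt Limsup_bounded[of "\<lambda>n. ereal (cf_ratio x n)" "ereal t" sequentially] by (auto simp: not_le)
    then obtain n where n: "n \<ge> Q" "cf_ratio x n > t"
      unfolding eventually_sequentially by (auto simp: not_le)
    define q where "q = conv_den x n"
    define e where "e = \<bar>x - cf_convergent x n\<bar>"
    have q: "q \<ge> 1" using conv_den_pos[OF x'] by (simp add: q_def)
    have e: "0 < e" "e < 1"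
      using cf_convergent_neq[OF x', of n] conv_error_less_1[OF x', of n] by (auto simp: e_def)
    then have \<Lambda>: "- ln e > 0" by simp
    have "t < 1 - 2 * ln q / (- ln e)"
      using n(2) cf_ratio_bounds(4)[OF x', of n] by (simp add: q_def e_def)
    then have "2 * ln q / (- ln e) < 1 - t" by simp
    then have "2 * ln q < (1 - t) * (- ln e)"
      using \<Lambda> by (simp only: pos_divide_less_eq)
    then have "\<beta> * ln q < - ln e"
      using True by (simp add: \<beta>_def field_simps)
    then have "ln e < ln (real q powr - \<beta>)"
      using q by (simp add: ln_powr)
    then have "e < real q powr - \<beta>"
      using e q by (subst (asm) ln_less_cancel_iff) auto
    then have "\<bar>x - real (conv_num x n) / real q\<bar> \<le> real q powr - \<beta>"
      by (simp add: e_def q_def cf_convergent_eq_num_den[OF x'])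
    moreover have "q \<ge> Q" using conv_den_ge[OF x', of n] n(1) by (simp add: q_def)
    moreover have "conv_num x n \<le> q" unfolding q_def by (rule conv_num_le_den[OF x'])
    ultimately show "\<exists>q\<ge>Q. \<exists>p\<le>q. \<bar>x - real p / real q\<bar> \<le> real q powr - \<beta>" by blast
  qed
  then have "hausdorff_measure s ?E \<le> hausdorff_measure s ?A" by (rule hausdorff_measure_mono)
  then show ?thesis unfolding well_approximable_null[OF \<beta>] by simp
qed

section \<open>Counting fractions of bounded denominator in an interval\<close>

definition frac_nums :: "real \<Rightarrow> real \<Rightarrow> nat \<Rightarrow> int set" where
  "frac_nums c L q = {p. real q * c \<le> real_of_int p \<and> real_of_int p \<le> real q * (c + L)}"

lemma frac_nums_card:
  assumes "0 < L"
  shows "finite (frac_nums c L q)"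
    and "real q * L - 1 \<le> card (frac_nums c L q)" "card (frac_nums c L q) \<le> real q * L + 1"
proof -
  have eq: "frac_nums c L q = {\<lceil>real q * c\<rceil>..\<lfloor>real q * (c + L)\<rfloor>}"
    by (auto simp: frac_nums_def ceiling_le_iff le_floor_iff)
  then show "finite (frac_nums c L q)" by simp
  have "0 \<le> real q * L" using assms by simp
  then show "real q * L - 1 \<le> card (frac_nums c L q)" "card (frac_nums c L q) \<le> real q * L + 1"
    unfolding eq card_atLeastAtMost_int distrib_left by linarith+
qed

definition frac_pairs :: "real \<Rightarrow> real \<Rightarrow> nat \<Rightarrow> (nat \<times> int) set" where
  "frac_pairs c L m = (SIGMA q:{1..m}. frac_nums c L q)"

lemma frac_pairs_card:
  assumes "0 < L"
  shows "finite (frac_pairs c L m)"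
    and "L * (real m * (real m + 1) / 2) - m \<le> card (frac_pairs c L m)"
    and "card (frac_pairs c L m) \<le> L * (real m * (real m + 1) / 2) + m"
proof -
  show "finite (frac_pairs c L m)"
    unfolding frac_pairs_def using frac_nums_card(1)[OF assms] by blast
  have card: "real (card (frac_pairs c L m)) = (\<Sum>q=1..m. real (card (frac_nums c L q)))"
    unfolding frac_pairs_def using frac_nums_card(1)[OF assms] by simp
  have tri: "(\<Sum>q=1..m. real q * L) = L * (real m * (real m + 1) / 2)"
    by (induction m) (auto simp: field_simps)
  have "(\<Sum>q=1..m. real q * L - 1) \<le> card (frac_pairs c L m)"
    unfolding card by (intro sum_mono frac_nums_card assms)
  then show "L * (real m * (real m + 1) / 2) - m \<le> card (frac_pairs c L m)"
    unfolding sum_subtractf tri by simp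
  have "card (frac_pairs c L m) \<le> (\<Sum>q=1..m. real q * L + 1)"
    unfolding card by (intro sum_mono frac_nums_card assms)
  then show "card (frac_pairs c L m) \<le> L * (real m * (real m + 1) / 2) + m"
    unfolding sum.distrib tri by simp
qed

lemma sum_inverse_squares_le:
  assumes "Q \<ge> 2"
  shows "(\<Sum>t=2..Q. 1 / (real t)\<^sup>2) \<le> 3 / 4 - 1 / real Q"
  using assms
proof (induction Q rule: dec_induct)
  case base
  then show ?case by simp
next
  case (step Q)
  have "1 / (real (Suc Q))\<^sup>2 \<le> 1 / (real Q * real (Suc Q))"
    using step.hyps unfolding power2_eq_square
    by (intro divide_left_mono mult_right_mono) auto
  also have "\<dots> = 1 / real Q - 1 / real (Suc Q)"
    using step.hyps by (simp add: field_simps)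
  finally show ?case using step by simp
qed

lemma sum_inverse_le_sqrt:
  "(\<Sum>t=2..Q. 1 / real t) \<le> 2 * sqrt (real Q)"
proof (induction Q)
  case (Suc Q)
  show ?case
  proof (cases "Q = 0")
    case False
    define a b where "a = sqrt (real Q)" and "b = sqrt (real (Suc Q))"
    have ab: "1 \<le> b" "0 \<le> a" "a \<le> b" using False by (auto simp: a_def b_def)
    have sq: "b * b - a * a = 1" by (simp add: a_def b_def)
    have "1 = (b - a) * (b + a)" using sq by (simp add: algebra_simps)
    also have "\<dots> \<le> (b - a) * (2 * b)" using ab by (intro mult_left_mono) auto
    also have "\<dots> \<le> (b - a) * (2 * (b * b))" using ab by (intro mult_left_mono) auto
    finally have "1 \<le> 2 * (b - a) * real (Suc Q)" by (simp add: b_def algebra_simps)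
    then have "1 / real (Suc Q) \<le> 2 * (b - a)" by (simp add: field_simps)
    then show ?thesis using Suc False by (simp add: a_def b_def)
  qed simp
qed simp

text \<open>
Among the roughly \<open>L Q\<^sup>2 / 2\<close> pairs, those with common divisor \<open>t\<close> are \<open>t\<close> times a pair with
denominator at most \<open>Q / t\<close>, so there are about \<open>L Q\<^sup>2 / (2 t\<^sup>2)\<close> of them. Since
\<open>1 / 2\<^sup>2 + 1 / 3\<^sup>2 + \<dots> \<le> 3 / 4\<close>, at least a quarter of the pairs are coprime, apart from an error of
lower order in \<open>Q\<close>.
\<close>

lemma coprime_frac_pairs_card:
  assumes L: "0 < L" and Q: "Q \<ge> 2"
  shows "L * (real Q)\<^sup>2 / 8 - Q - (L + 2) * real Q * sqrt Q
           \<le> card {(q, p) \<in> frac_pairs c L Q. coprime (int q) p}"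
    (is "_ \<le> real (card ?C)")
proof -
  define P where "P = frac_pairs c L"
  have fin: "finite (P m)" for m unfolding P_def by (rule frac_pairs_card(1)[OF L])
  let ?scale = "\<lambda>t::nat. \<lambda>(q, p). (t * q, int t * p)"
  have cover: "P Q \<subseteq> ?C \<union> (\<Union>t\<in>{2..Q}. ?scale t ` P (Q div t))"
  proof safe
    fix q p
    assume qp: "(q, p) \<in> P Q" and notin: "(q, p) \<notin> (\<Union>t\<in>{2..Q}. ?scale t ` P (Q div t))"
    show "(q, p) \<in> frac_pairs c L Q" using qp by (simp add: P_def)
    show "coprime (int q) p"
    proof (rule ccontr)
      assume nc: "\<not> coprime (int q) p"
      define t where "t = nat (gcd (int q) p)"
      have q: "1 \<le> q" "q \<le> Q" and p: "p \<in> frac_nums c L q"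
        using qp by (auto simp: P_def frac_pairs_def)
      have g0: "gcd (int q) p > 0" using q by simp
      have "gcd (int q) p \<noteq> 1" using nc by (simp add: coprime_iff_gcd_eq_1)
      then have t2: "t \<ge> 2" using g0 unfolding t_def by linarith
      have it: "int t = gcd (int q) p" using g0 by (simp add: t_def)
      then have "int t dvd int q" "int t dvd p" by simp_all
      then have "t dvd q" "int t dvd p" unfolding int_dvd_int_iff .
      then obtain q' p' where q': "q = t * q'" and p': "p = int t * p'"
        by (elim dvdE)
      have tQ: "t \<le> Q" using q q' t2 by (cases q') auto
      have "q' \<le> Q div t"
        using q q' t2 by (simp add: less_eq_div_iff_mult_less_eq mult.commute)
      moreover have "q' \<ge> 1" using q q' by (cases q') auto
      moreover have "p' \<in> frac_nums c L q'"
      proof -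
        have "real t * (real q' * c) \<le> real t * p'" "real t * p' \<le> real t * (real q' * (c + L))"
          using p unfolding frac_nums_def q' p' by (simp_all add: mult.assoc)
        then show ?thesis using t2 unfolding frac_nums_def by simp
      qed
      ultimately have "(q', p') \<in> P (Q div t)" by (simp add: P_def frac_pairs_def)
      then have "(q, p) \<in> ?scale t ` P (Q div t)" unfolding q' p' by force
      then show False using notin t2 tQ by auto
    qed
  qed
  have finC: "finite ?C"
    by (rule finite_subset[OF _ fin[of Q]]) (auto simp: P_def)
  have "card (P Q) \<le> card (?C \<union> (\<Union>t\<in>{2..Q}. ?scale t ` P (Q div t)))"
    by (rule card_mono[OF _ cover]) (use fin finC in auto)
  also have "\<dots> \<le> card ?C + card (\<Union>t\<in>{2..Q}. ?scale t ` P (Q div t))"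
    by (rule card_Un_le)
  also have "card (\<Union>t\<in>{2..Q}. ?scale t ` P (Q div t)) \<le> (\<Sum>t=2..Q. card (?scale t ` P (Q div t)))"
    by (rule card_UN_le) simp
  also have "\<dots> \<le> (\<Sum>t=2..Q. card (P (Q div t)))"
    by (intro sum_mono card_image_le fin)
  finally have 1: "real (card (P Q)) \<le> card ?C + (\<Sum>t=2..Q. real (card (P (Q div t))))"
    by (simp flip: of_nat_sum of_nat_add)
  have "(\<Sum>t=2..Q. real (card (P (Q div t)))) \<le>
      (\<Sum>t=2..Q. L * (real Q)\<^sup>2 / 2 * (1 / (real t)\<^sup>2) + (L / 2 + 1) * real Q * (1 / real t))"
  proof (rule sum_mono)
    fix t assume t: "t \<in> {2..Q}"
    define m where "m = real (Q div t)"
    have m: "0 \<le> m" "m \<le> real Q / real t"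
      unfolding m_def using t div_times_less_eq_dividend[of Q t]
      by (auto simp: pos_le_divide_eq simp flip: of_nat_mult)
    have "real (card (P (Q div t))) \<le> L * (m * (m + 1) / 2) + m"
      using frac_pairs_card(3)[OF L, of c "Q div t"] by (simp add: P_def m_def)
    also have "\<dots> = L / 2 * m\<^sup>2 + (L / 2 + 1) * m" by (simp add: power2_eq_square field_simps)
    also have "\<dots> \<le> L / 2 * (real Q / real t)\<^sup>2 + (L / 2 + 1) * (real Q / real t)"
      using m L by (intro add_mono mult_left_mono power_mono) auto
    also have "\<dots> = L * (real Q)\<^sup>2 / 2 * (1 / (real t)\<^sup>2) + (L / 2 + 1) * real Q * (1 / real t)"
      by (simp add: power_divide)
    finally show "real (card (P (Q div t))) \<le> \<dots>" .
  qed
  also have "\<dots> = L * (real Q)\<^sup>2 / 2 * (\<Sum>t=2..Q. 1 / (real t)\<^sup>2) +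
      (L / 2 + 1) * real Q * (\<Sum>t=2..Q. 1 / real t)"
    by (simp only: sum.distrib sum_distrib_left)
  also have "\<dots> \<le> L * (real Q)\<^sup>2 / 2 * (3 / 4) + (L / 2 + 1) * real Q * (2 * sqrt Q)"
  proof -
    have "0 \<le> 1 / real Q" by simp
    then have "(\<Sum>t=2..Q. 1 / (real t)\<^sup>2) \<le> 3 / 4"
      using sum_inverse_squares_le[OF Q] by linarith
    then show ?thesis
      using L sum_inverse_le_sqrt[of Q] by (intro add_mono mult_left_mono) auto
  qed
  finally have 2: "(\<Sum>t=2..Q. real (card (P (Q div t)))) \<le>
      L * (real Q)\<^sup>2 * (3 / 8) + (L + 2) * real Q * sqrt Q"
    by (simp add: algebra_simps)
  have "L * (real Q)\<^sup>2 / 2 - Q \<le> L * (real Q * (real Q + 1) / 2) - Q"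
    using L by (simp add: power2_eq_square algebra_simps)
  also have "\<dots> \<le> card (P Q)"
    unfolding P_def by (rule frac_pairs_card(2)[OF L])
  finally show ?thesis using 1 2 by (simp add: algebra_simps)
qed

text \<open>
Coprime pairs represent distinct rationals. The order \<open>Q\<^sup>2\<close> is the largest possible for rationals of denominator at most \<open>Q\<close>. It is essential
that the constant is proportional to \<open>L\<close> and that \<open>Q0\<close> does not depend on the position \<open>c\<close>. The
number of rationals is prescribed exactly so that all intervals of one Cantor level get the same
number of children.
\<close>

lemma many_rationals_in_interval:
  assumes L: "0 < L"
  shows "\<exists>Q0. \<forall>Q\<ge>Q0. \<forall>c. \<exists>S. finite S \<and> S \<subseteq> {c..c + L} \<and>
           (\<forall>y\<in>S. \<exists>(p::int) (q::nat). 1 \<le> q \<and> q \<le> Q \<and> y = p / q) \<and>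
           card S = nat \<lfloor>L * (real Q)\<^sup>2 / 16\<rfloor>"
proof -
  have "eventually (\<lambda>Q::nat. L * (real Q)\<^sup>2 / 16 \<le>
      L * (real Q)\<^sup>2 / 8 - Q - (L + 2) * real Q * sqrt Q) at_top"
    using L by real_asymp
  then obtain Q1 where Q1: "\<And>Q::nat. Q \<ge> Q1 \<Longrightarrow> L * (real Q)\<^sup>2 / 16 \<le>
      L * (real Q)\<^sup>2 / 8 - Q - (L + 2) * real Q * sqrt Q"
    unfolding eventually_sequentially by blast
  show ?thesis
  proof (intro exI[of _ "max 2 Q1"] allI impI)
    fix Q :: nat and c :: real
    assume "max 2 Q1 \<le> Q"
    then have Q: "Q \<ge> 2" "Q \<ge> Q1" by auto
    define C where "C = {(q, p) \<in> frac_pairs c L Q. coprime (int q) p}"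
    define v where "v = (\<lambda>(q::nat, p::int). p / q)"
    have "L * (real Q)\<^sup>2 / 16 \<le> card C"
      using Q1[OF Q(2)] coprime_frac_pairs_card[OF L Q(1), of c] unfolding C_def by linarith
    moreover have "inj_on v C"
    proof (rule inj_onI)
      fix a b assume ab: "a \<in> C" "b \<in> C" "v a = v b"
      obtain q p q' p' where a: "a = (q, p)" and b: "b = (q', p')" by (cases a, cases b)
      have q: "q \<ge> 1" "q' \<ge> 1" and cop: "coprime p (int q)" "coprime p' (int q')"
        using ab unfolding a b C_def frac_pairs_def by (auto simp: coprime_commute)
      have "real_of_int p * q' = p' * q"
        using ab(3) q by (simp add: a b v_def field_simps)
      then have "p * int q' = p' * int q"
        by (metis of_int_eq_iff of_int_mult of_int_of_nat_eq)
      then have "\<bar>p * int q'\<bar> = \<bar>p' * int q\<bar>" by simp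
      then have "\<bar>p\<bar> = \<bar>p'\<bar> \<and> \<bar>int q\<bar> = \<bar>int q'\<bar>"
        using cop by (metis abs_mult coprime_crossproduct_int mult.commute coprime_commute)
      then have "q = q'" by simp
      then show "a = b" using \<open>p * int q' = p' * int q\<close> q by (simp add: a b)
    qed
    ultimately have "nat \<lfloor>L * (real Q)\<^sup>2 / 16\<rfloor> \<le> card (v ` C)"
      by (simp add: card_image) linarith
    then obtain S where S: "S \<subseteq> v ` C" "card S = nat \<lfloor>L * (real Q)\<^sup>2 / 16\<rfloor>" "finite S"
      by (rule obtain_subset_with_card_n)
    have "y \<in> {c..c + L} \<and> (\<exists>(p::int) (q::nat). 1 \<le> q \<and> q \<le> Q \<and> y = p / q)" if yS: "y \<in> S" for y
    proof -
      obtain q p where y: "y = p / q" and qp: "(q, p) \<in> C"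
        using yS S(1) unfolding v_def by (auto simp: image_iff subset_iff)
      then have q: "1 \<le> q" "q \<le> Q" and p: "real q * c \<le> p" "p \<le> real q * (c + L)"
        by (auto simp: C_def frac_pairs_def frac_nums_def)
      then have "y \<in> {c..c + L}" unfolding y by (simp add: field_simps)
      then show ?thesis using q y by blast
    qed
    then show "\<exists>S. finite S \<and> S \<subseteq> {c..c + L} \<and>
        (\<forall>y\<in>S. \<exists>(p::int) (q::nat). 1 \<le> q \<and> q \<le> Q \<and> y = p / q) \<and>
        card S = nat \<lfloor>L * (real Q)\<^sup>2 / 16\<rfloor>"
      using S by (intro exI[of _ S]) auto
  qed
qed

section \<open>Homogeneous Cantor sets of infinite Hausdorff measure\<close>

lemma separated_set_card_le:
  fixes S :: "real set"
  assumes "S \<subseteq> {a..a + l}" "0 < d" "0 \<le> l"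
    and sep: "\<And>x y. x \<in> S \<Longrightarrow> y \<in> S \<Longrightarrow> x \<noteq> y \<Longrightarrow> d \<le> \<bar>x - y\<bar>"
  shows "card S \<le> l / d + 1"
proof -
  define f where "f x = nat \<lfloor>(x - a) / d\<rfloor>" for x
  have "inj_on f S"
  proof (rule inj_onI, rule ccontr)
    fix x y assume xy: "x \<in> S" "y \<in> S" "f x = f y" "x \<noteq> y"
    have "\<lfloor>(x - a) / d\<rfloor> = \<lfloor>(y - a) / d\<rfloor>"
    proof -
      have "0 \<le> (x - a) / d" "0 \<le> (y - a) / d"
        using xy(1,2) assms(1,2) by (auto intro!: divide_nonneg_pos)
      then show ?thesis using xy(3) by (simp add: f_def eq_nat_nat_iff)
    qed
    then have "\<bar>(x - a) / d - (y - a) / d\<bar> < 1" by linarith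
    also have "(x - a) / d - (y - a) / d = (x - y) / d" by (simp add: diff_divide_distrib)
    finally have "\<bar>x - y\<bar> < d" using assms(2) by (simp add: abs_divide)
    then show False using sep[of x y] xy by simp
  qed
  moreover have "f ` S \<subseteq> {..nat \<lfloor>l / d\<rfloor>}"
    using assms(1,2) unfolding f_def
    by (auto intro!: nat_mono floor_mono divide_right_mono)
  ultimately have "card S \<le> card {..nat \<lfloor>l / d\<rfloor>}"
    by (metis card_inj_on_le finite_atMost)
  also have "real (card {..nat \<lfloor>l / d\<rfloor>}) \<le> l / d + 1"
    using assms by simp
  finally show ?thesis by simp
qed

text \<open>
A homogeneous Cantor construction on the line: \<open>C k\<close> is the set of left endpoints of the level
\<open>k\<close> intervals, all of length \<open>\<rho> k\<close>, and every interval of level \<open>k\<close> has \<open>N (k + 1)\<close> children. The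
hypothesis \<open>many_children\<close> says that the children, at mutual distance \<open>d (k + 1)\<close>, are up to the
factor \<open>B\<close> as dense in their parent as this distance permits. The hypothesis \<open>mass\<close> says that
the natural probability measure gives each level \<open>k\<close> interval at most \<open>1 / k\<close> of the \<open>s\<close>-th power of
its length. A constant in place of the factor \<open>k\<close> would give positive \<open>s\<close>-dimensional measure;
the growing factor makes it infinite.
\<close>

locale cantor_scheme =
  fixes C :: "nat \<Rightarrow> real set" and \<rho> d :: "nat \<Rightarrow> real" and N :: "nat \<Rightarrow> nat" and s B :: real
  assumes finite_C: "finite (C k)" and C_nonempty: "C k \<noteq> {}"
    and card_C_Suc: "card (C (Suc k)) = N (Suc k) * card (C k)"
    and card_children: "c \<in> C k \<Longrightarrow>
          card {c' \<in> C (Suc k). {c'..c' + \<rho> (Suc k)} \<subseteq> {c..c + \<rho> k}} \<le> N (Suc k)"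
    and parent: "c' \<in> C (Suc k) \<Longrightarrow> \<exists>c\<in>C k. {c'..c' + \<rho> (Suc k)} \<subseteq> {c..c + \<rho> k}"
    and separated: "c \<in> C k \<Longrightarrow> c' \<in> C k \<Longrightarrow> c \<noteq> c' \<Longrightarrow> d k \<le> \<bar>c - c'\<bar>"
    and \<rho>_pos: "0 < \<rho> k" and \<rho>_tendsto: "\<rho> \<longlonglongrightarrow> 0" and d_pos: "0 < d k"
    and many_children: "\<rho> k \<le> B * N (Suc k) * d (Suc k)"
    and mass: "real k \<le> card (C k) * \<rho> k powr s"
    and s_range: "0 \<le> s" "s \<le> 1" and B_ge_1: "1 \<le> B"
begin

definition level :: "nat \<Rightarrow> real set" where
  "level k = (\<Union>c\<in>C k. {c..c + \<rho> k})"

text \<open>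
The proportion of \<open>C k\<close> that is hit replaces the mass of \<open>U\<close> under the natural measure on the Cantor
set, at resolution \<open>k\<close>.
\<close>

definition hit :: "nat \<Rightarrow> real set \<Rightarrow> real set" where
  "hit k U = {c \<in> C k. {c..c + \<rho> k} \<inter> U \<noteq> {}}"

lemma card_C_pos: "0 < card (C k)"
  using finite_C C_nonempty by (simp add: card_gt_0_iff)

lemma finite_hit: "finite (hit k U)"
  using finite_C by (simp add: hit_def)

lemma \<rho>_Suc_le: "\<rho> (Suc k) \<le> \<rho> k"
proof -
  obtain c' where "c' \<in> C (Suc k)" using C_nonempty by blast
  then obtain c where "{c'..c' + \<rho> (Suc k)} \<subseteq> {c..c + \<rho> k}" using parent by blast
  then show ?thesis using \<rho>_pos[of "Suc k"] by simp
qed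

lemma \<rho>_decseq: "k \<le> l \<Longrightarrow> \<rho> l \<le> \<rho> k"
  by (rule lift_Suc_antimono_le[of \<rho>, OF \<rho>_Suc_le])

lemma level_antimono: "k \<le> l \<Longrightarrow> level l \<subseteq> level k"
proof (rule lift_Suc_antimono_le)
  fix n
  show "level (Suc n) \<subseteq> level n"
    using parent[of _ n] unfolding level_def by blast
qed

lemma compact_level: "compact (level k)"
  unfolding level_def by (intro compact_UN finite_C) simp

lemma level_nonempty: "level k \<noteq> {}"
  using C_nonempty[of k] \<rho>_pos[of k] unfolding level_def by (auto simp: less_imp_le)

lemma card_hit_Suc: "card (hit (Suc k) U) \<le> N (Suc k) * card (hit k U)"
proof -
  let ?ch = "\<lambda>c. {c' \<in> C (Suc k). {c'..c' + \<rho> (Suc k)} \<subseteq> {c..c + \<rho> k}}"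
  have "hit (Suc k) U \<subseteq> (\<Union>c\<in>hit k U. ?ch c)"
  proof
    fix c' assume "c' \<in> hit (Suc k) U"
    then have c': "c' \<in> C (Suc k)" "{c'..c' + \<rho> (Suc k)} \<inter> U \<noteq> {}" by (auto simp: hit_def)
    then obtain c where c: "c \<in> C k" "{c'..c' + \<rho> (Suc k)} \<subseteq> {c..c + \<rho> k}"
      using parent by blast
    then have "c \<in> hit k U" using c' unfolding hit_def by blast
    then show "c' \<in> (\<Union>c\<in>hit k U. ?ch c)" using c c' by blast
  qed
  then have "card (hit (Suc k) U) \<le> card (\<Union>c\<in>hit k U. ?ch c)"
    by (intro card_mono) (auto simp: finite_hit finite_C)
  also have "\<dots> \<le> (\<Sum>c\<in>hit k U. card (?ch c))"
    by (rule card_UN_le[OF finite_hit])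
  also have "\<dots> \<le> (\<Sum>c\<in>hit k U. N (Suc k))"
    by (intro sum_mono card_children) (simp add: hit_def)
  finally show ?thesis by (simp add: mult.commute)
qed

lemma hit_fraction_antimono:
  assumes "k \<le> l"
  shows "card (hit l U) * card (C k) \<le> card (hit k U) * card (C l)"
  using assms
proof (induction l rule: dec_induct)
  case (step l)
  have "card (hit (Suc l) U) * card (C k) \<le> N (Suc l) * card (hit l U) * card (C k)"
    by (intro mult_le_mono1 card_hit_Suc)
  also have "\<dots> \<le> N (Suc l) * (card (hit k U) * card (C l))"
    using step.IH by (simp add: mult.assoc)
  finally show ?case by (simp add: card_C_Suc mult_ac)
qed simp

lemma card_hit_le:
  assumes "U \<subseteq> {u..u + R}" "0 \<le> R"
  shows "card (hit k U) \<le> (R + \<rho> k) / d k + 1"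
proof (rule separated_set_card_le)
  show "hit k U \<subseteq> {u - \<rho> k..u - \<rho> k + (R + \<rho> k)}"
    using assms(1) unfolding hit_def by fastforce
  show "0 \<le> R + \<rho> k" using assms(2) \<rho>_pos[of k] by simp
qed (auto simp: d_pos hit_def intro: separated)

text \<open>
The mass distribution estimate. Let \<open>k\<close> be the first level with \<open>\<rho> k \<le> R\<close>, and \<open>j\<close> the one before
it. If \<open>R\<close> is below the separation \<open>d k\<close>, only three intervals of level \<open>k\<close> are hit and \<open>mass\<close> at level
\<open>k\<close> suffices. Otherwise at most \<open>3 R / d k\<close> are hit; as the children fill their parent evenly, this is
up to the factor \<open>3 B\<close> the fraction \<open>R / \<rho> j\<close> of the children of a single interval, and \<open>mass\<close> at level \<open>j\<close> applies because
\<open>R / \<rho> j \<le> (R / \<rho> j)\<^sup>s\<close>.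
\<close>

lemma card_hit_small:
  assumes U: "U \<subseteq> {u..u + R}" and R: "0 < R" "R < \<rho> m" and m: "1 \<le> m"
  shows "\<exists>k0. \<forall>k\<ge>k0. card (hit k U) \<le> 3 * B * R powr s / m * card (C k)"
proof -
  have "\<exists>k. \<rho> k \<le> R"
    using order_tendstoD(2)[OF \<rho>_tendsto R(1)] unfolding eventually_sequentially
    by (meson less_imp_le order_refl)
  then have k0: "\<rho> (LEAST k. \<rho> k \<le> R) \<le> R" by (rule LeastI_ex)
  moreover have "\<not> (LEAST k. \<rho> k \<le> R) \<le> m"
    using k0 R(2) \<rho>_decseq by (meson leD order_trans)
  ultimately obtain j where j: "(LEAST k. \<rho> k \<le> R) = Suc j" "m \<le> j"
    by (cases "LEAST k. \<rho> k \<le> R") auto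
  define k where "k = Suc j"
  have \<rho>k: "\<rho> k \<le> R" using k0 j by (simp add: k_def)
  have \<rho>j: "R < \<rho> j" using not_less_Least[of j "\<lambda>k. \<rho> k \<le> R"] j by simp
  have hit: "real (card (hit k U)) \<le> (R + \<rho> k) / d k + 1"
    using card_hit_le[OF U] R by simp
  also have "\<dots> \<le> 2 * R / d k + 1"
    using \<rho>k d_pos[of k] by (intro add_right_mono divide_right_mono) auto
  finally have hit: "real (card (hit k U)) \<le> 2 * R / d k + 1" .
  have base: "real (card (hit k U)) \<le> 3 * B * R powr s / m * card (C k)"
  proof (cases "R < d k")
    case True
    then have "2 * R / d k \<le> 2" using d_pos[of k] R by (simp add: divide_simps)
    then have "real (card (hit k U)) \<le> 3 * 1" using hit by simp
    also have "\<dots> \<le> 3 * (B * (R powr s * card (C k) / m))"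
    proof -
      have "real m \<le> real k" using j by (simp add: k_def)
      also have "\<dots> \<le> card (C k) * \<rho> k powr s" by (rule mass)
      also have "\<dots> \<le> card (C k) * R powr s"
        using \<rho>k \<rho>_pos[of k] s_range by (intro mult_left_mono powr_mono2) auto
      finally have "1 \<le> R powr s * card (C k) / m" using m by (simp add: field_simps)
      then have "1 * 1 \<le> B * (R powr s * card (C k) / m)" using B_ge_1 by (intro mult_mono) auto
      then show ?thesis by simp
    qed
    finally show ?thesis by (simp add: field_simps)
  next
    case False
    then have "1 \<le> R / d k" using d_pos[of k] by (simp add: field_simps)
    then have "real (card (hit k U)) \<le> 3 * (R / d k)" using hit by simp
    also have "R / d k \<le> R * (B * N k / \<rho> j)"
    proof -
      have "1 / d k \<le> B * N k / \<rho> j"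
        using many_children[of j] d_pos[of k] \<rho>_pos[of j] by (simp add: k_def field_simps)
      then have "R * (1 / d k) \<le> R * (B * N k / \<rho> j)"
        using R by (intro mult_left_mono) auto
      then show ?thesis by simp
    qed
    also have "R * (B * N k / \<rho> j) = B * N k * (R powr s * (R powr (1 - s) / \<rho> j))"
      using R by (simp add: powr_add[symmetric])
    also have "\<dots> \<le> B * N k * (R powr s * (card (C j) / m))"
    proof -
      have "R powr (1 - s) / \<rho> j \<le> \<rho> j powr (1 - s) / \<rho> j"
        using R \<rho>j s_range by (intro divide_right_mono powr_mono2) auto
      also have "\<dots> = 1 / \<rho> j powr s"
        using \<rho>_pos[of j] by (simp add: powr_diff)
      also have "\<dots> \<le> card (C j) / m"
      proof -
        have "real m \<le> card (C j) * \<rho> j powr s"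
          using j(2) mass[of j] by linarith
        then show ?thesis using m \<rho>_pos[of j] by (simp add: field_simps)
      qed
      finally show ?thesis using B_ge_1 by (intro mult_left_mono) auto
    qed
    finally show ?thesis by (simp add: card_C_Suc k_def field_simps)
  qed
  show ?thesis
  proof (intro exI[of _ k] allI impI)
    fix l assume l: "k \<le> l"
    have "real (card (hit l U)) * card (C k) \<le> real (card (hit k U)) * card (C l)"
      using hit_fraction_antimono[OF l, of U] by (simp flip: of_nat_mult)
    also have "\<dots> \<le> (3 * B * R powr s / m * card (C k)) * card (C l)"
      by (intro mult_right_mono base) simp
    finally have "real (card (hit l U)) * card (C k) \<le> (3 * B * R powr s / m * card (C l)) * card (C k)"
      by (simp add: mult_ac)
    then show "real (card (hit l U)) \<le> 3 * B * R powr s / m * card (C l)"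
      by (rule mult_right_le_imp_le) (simp add: card_C_pos)
  qed
qed

text \<open>
A covering set is replaced by an open interval so that compactness can be used. An interval of
length four times the diameter \<open>D\<close> costs a factor \<open>4\<^sup>s \<le> 4\<close>. If \<open>D = 0\<close> and \<open>s > 0\<close>, the gauge is \<open>0\<close>
and the cost is absorbed by \<open>e\<close>; if \<open>s = 0\<close>, any interval has gauge \<open>1\<close>.
\<close>

lemma open_enlargement:
  assumes U: "bounded U" "diameter U \<le> \<rho> m / 8" and m: "1 \<le> m" and e: "0 < e"
  shows "\<exists>V w. open V \<and> U \<subseteq> V \<and> 0 \<le> w \<and> ennreal w \<le> 4 * hausdorff_gauge s U + ennreal e \<and>
           (\<exists>k0. \<forall>k\<ge>k0. card (hit k V) \<le> 3 * B * w / m * card (C k))"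
proof (cases "U = {}")
  case True
  then show ?thesis by (intro exI[of _ "{}"] exI[of _ 0]) (auto simp: hit_def)
next
  case False
  then obtain u where u: "u \<in> U" by blast
  define D where "D = diameter U"
  have D0: "0 \<le> D" unfolding D_def by (rule diameter_ge_0[OF U(1)])
  have \<rho>m: "0 < \<rho> m" by (rule \<rho>_pos)
  obtain R where R: "0 < R" "R < \<rho> m" "2 * D < R"
    and w: "ennreal (R powr s) \<le> 4 * hausdorff_gauge s U + ennreal e"
  proof (cases "D = 0 \<and> s \<noteq> 0")
    case True
    define R where "R = min (\<rho> m / 2) (e powr (1 / s))"
    have "R powr s \<le> (e powr (1 / s)) powr s"
      using e \<rho>m s_range by (intro powr_mono2) (auto simp: R_def)
    also have "\<dots> = e" using e True by (simp add: powr_powr)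
    finally have "ennreal (R powr s) \<le> 4 * hausdorff_gauge s U + ennreal e"
      using e by (simp add: add_increasing ennreal_leI)
    then show thesis using that[of R] \<rho>m e True by (auto simp: R_def)
  next
    case False
    define R where "R = (if D = 0 then \<rho> m / 2 else 4 * D)"
    have g: "hausdorff_gauge s U = ennreal (if s = 0 then 1 else D powr s)"
      using \<open>U \<noteq> {}\<close> by (simp add: hausdorff_gauge_def D_def)
    have R0: "0 < R" using D0 \<rho>m by (simp add: R_def)
    have "R powr s \<le> 4 * (if s = 0 then 1 else D powr s)"
    proof (cases "s = 0")
      case True
      then show ?thesis using R0 by simp
    next
      case s: False
      then have "D > 0" using False D0 by simp
      then have "R powr s = 4 powr s * D powr s" by (simp add: R_def powr_mult)
      also have "4 powr s \<le> 4 powr (1::real)" using s_range by (intro powr_mono) auto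
      finally show ?thesis using s by (simp add: mult_right_mono)
    qed
    then have "ennreal (R powr s) \<le> ennreal (4 * (if s = 0 then 1 else D powr s))"
      by (rule ennreal_leI)
    also have "\<dots> = 4 * hausdorff_gauge s U"
      unfolding g by (simp add: ennreal_mult)
    finally have "ennreal (R powr s) \<le> 4 * hausdorff_gauge s U + ennreal e"
      by (simp add: add_increasing2)
    then show thesis using that[of R] R0 D0 U(2) \<rho>m by (auto simp: R_def D_def)
  qed
  have "ball u (R / 2) \<subseteq> {(u - R / 2)..(u - R / 2) + R}"
    unfolding ball_def dist_real_def subset_iff atLeastAtMost_iff mem_Collect_eq abs_less_iff
    by (simp add: algebra_simps)
  from card_hit_small[OF this R(1,2) m]
  have "\<exists>k0. \<forall>k\<ge>k0. card (hit k (ball u (R / 2))) \<le> 3 * B * R powr s / m * card (C k)" .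
  moreover have "U \<subseteq> ball u (R / 2)"
  proof
    fix v assume "v \<in> U"
    then have "dist u v \<le> D" unfolding D_def by (intro diameter_bounded_bound U u)
    then show "v \<in> ball u (R / 2)" using R by simp
  qed
  ultimately show ?thesis
    using w by (intro exI[of _ "ball u (R / 2)"] exI[of _ "R powr s"]) auto
qed

text \<open>
Finitely many of the enlarged sets already cover some level, by compactness. At a deep enough
level \<open>l\<close> each of them hits at most the fraction \<open>3 B w i / m\<close> of the intervals, while together they hit
all; so the weights \<open>w i\<close> add up to at least \<open>m / (3 B)\<close>. The summand \<open>1\<close> is the total cost of
the enlargements.
\<close>

lemma cover_sum_lower_bound:
  assumes cov: "(\<Inter>k. level k) \<subseteq> (\<Union>i. U i)"
    and U: "\<And>i. bounded (U i)" "\<And>i. diameter (U i) \<le> \<rho> m / 8" and m: "1 \<le> m"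
  shows "ennreal (m / (3 * B)) \<le> 4 * (\<Sum>i. hausdorff_gauge s (U i)) + 1"
proof -
  define e where "e i = (1 / 2 :: real) ^ Suc i" for i
  have e: "0 < e i" for i by (simp add: e_def)
  obtain V w k0 where V: "\<And>i. open (V i)" "\<And>i. U i \<subseteq> V i"
    and w: "\<And>i. 0 \<le> w i" "\<And>i. ennreal (w i) \<le> 4 * hausdorff_gauge s (U i) + ennreal (e i)"
    and k0: "\<And>i k. k \<ge> k0 i \<Longrightarrow> card (hit k (V i)) \<le> 3 * B * w i / m * card (C k)"
  proof -
    define good where "good i V w k0 \<longleftrightarrow> open V \<and> U i \<subseteq> V \<and> 0 \<le> w \<and>
        ennreal w \<le> 4 * hausdorff_gauge s (U i) + ennreal (e i) \<and>
        (\<forall>k\<ge>k0. card (hit k V) \<le> 3 * B * w / m * card (C k))" for i V w k0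
    have "\<exists>V w k0. good i V w k0" for i
      using open_enlargement[OF U(1)[of i] U(2)[of i] m e[of i]] unfolding good_def by fast
    then obtain V w k0 where "\<And>i. good i (V i) (w i) (k0 i)" by metis
    then show thesis using that[of V w k0] unfolding good_def by blast
  qed
  define W where "W = (\<Union>i. V i)"
  have W: "open W" using V(1) by (auto simp: W_def)
  have covW: "(\<Inter>k. level k) \<subseteq> W" using cov V(2) unfolding W_def by blast
  have "\<exists>K. level K \<subseteq> W"
  proof (rule ccontr)
    assume "\<nexists>K. level K \<subseteq> W"
    then have "\<Inter> (range (\<lambda>k. level k - W)) \<noteq> {}"
      using level_antimono by (intro compact_nest compact_diff compact_level W) blast+
    then show False using covW by blast
  qed
  then obtain K where K: "level K \<subseteq> W" by blast
  obtain I where I: "finite I" "level K \<subseteq> (\<Union>i\<in>I. V i)"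
    by (rule compactE_image[OF compact_level[of K], of UNIV V])
       (use V(1) K in \<open>auto simp: W_def\<close>)
  define l where "l = Max (insert K (k0 ` I))"
  have l: "K \<le> l" "\<And>i. i \<in> I \<Longrightarrow> k0 i \<le> l" using I(1) by (auto simp: l_def)
  have "C l \<subseteq> (\<Union>i\<in>I. hit l (V i))"
  proof
    fix c assume c: "c \<in> C l"
    then have "c \<in> level l" using \<rho>_pos[of l] by (force simp: level_def)
    then obtain i where "i \<in> I" "c \<in> V i" using level_antimono[OF l(1)] I(2) by blast
    then show "c \<in> (\<Union>i\<in>I. hit l (V i))"
      using c \<rho>_pos[of l] by (force simp: hit_def)
  qed
  then have "card (C l) \<le> card (\<Union>i\<in>I. hit l (V i))"
    by (intro card_mono) (auto simp: finite_hit I(1))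
  also have "\<dots> \<le> (\<Sum>i\<in>I. card (hit l (V i)))"
    by (rule card_UN_le[OF I(1)])
  finally have "real (card (C l)) \<le> (\<Sum>i\<in>I. real (card (hit l (V i))))"
    by (simp flip: of_nat_sum)
  also have "\<dots> \<le> (\<Sum>i\<in>I. 3 * B * w i / m * card (C l))"
    by (intro sum_mono k0 l)
  also have "\<dots> = 3 * B / m * (\<Sum>i\<in>I. w i) * card (C l)"
    by (simp add: sum_distrib_left sum_distrib_right)
  finally have "1 * real (card (C l)) \<le> 3 * B / m * (\<Sum>i\<in>I. w i) * card (C l)" by simp
  then have "1 \<le> 3 * B / m * (\<Sum>i\<in>I. w i)"
    by (rule mult_right_le_imp_le) (simp add: card_C_pos)
  then have "m / (3 * B) \<le> (\<Sum>i\<in>I. w i)"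
    using m B_ge_1 by (simp add: field_simps)
  then have "ennreal (m / (3 * B)) \<le> ennreal (\<Sum>i\<in>I. w i)" by (rule ennreal_leI)
  also have "\<dots> = (\<Sum>i\<in>I. ennreal (w i))" using w(1) by simp
  also have "\<dots> \<le> (\<Sum>i\<in>I. 4 * hausdorff_gauge s (U i) + ennreal (e i))"
    by (intro sum_mono w)
  also have "\<dots> \<le> (\<Sum>i. 4 * hausdorff_gauge s (U i) + ennreal (e i))"
    by (intro sum_le_suminf I) auto
  also have "\<dots> = 4 * (\<Sum>i. hausdorff_gauge s (U i)) + (\<Sum>i. ennreal (e i))"
    by (simp add: suminf_add[symmetric])
  also have "(\<Sum>i. ennreal (e i)) = ennreal 1"
    using power_half_series unfolding e_def by (intro suminf_ennreal_eq) auto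
  finally show ?thesis by simp
qed

theorem hausdorff_measure_infinite: "hausdorff_measure s (\<Inter>k. level k) = \<infinity>"
proof -
  have low: "ennreal ((m / (3 * B) - 1) / 4) \<le> hausdorff_measure s (\<Inter>k. level k)" if m: "1 \<le> m" for m :: nat
  proof -
    have "ennreal ((m / (3 * B) - 1) / 4) \<le> hausdorff_premeasure s (\<rho> m / 8) (\<Inter>k. level k)"
      unfolding hausdorff_premeasure_def
    proof (rule INF_greatest)
      fix U :: "nat \<Rightarrow> real set"
      assume U: "U \<in> {U. (\<Inter>k. level k) \<subseteq> (\<Union>i. U i) \<and> (\<forall>i. bounded (U i) \<and> diameter (U i) \<le> \<rho> m / 8)}"
      define T where "T = (\<Sum>i. hausdorff_gauge s (U i))"
      have le: "ennreal (m / (3 * B)) \<le> 4 * T + 1"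
        unfolding T_def by (rule cover_sum_lower_bound) (use U m in auto)
      have "ennreal ((m / (3 * B) - 1) / 4) \<le> T"
      proof (cases T)
        case (real t)
        have "4 * T + 1 = ennreal (4 * t + 1)"
          using real by (simp add: ennreal_mult)
        then have "ennreal (m / (3 * B)) \<le> ennreal (4 * t + 1)"
          using le by (simp only:)
        then have "m / (3 * B) \<le> 4 * t + 1"
          using real(1) by (subst (asm) ennreal_le_iff) auto
        then show ?thesis unfolding real(2) by (intro ennreal_leI) simp
      qed simp
      then show "ennreal ((m / (3 * B) - 1) / 4) \<le> (\<Sum>i. hausdorff_gauge s (U i))"
        by (simp add: T_def)
    qed
    also have "\<dots> \<le> hausdorff_measure s (\<Inter>k. level k)"
      unfolding hausdorff_measure_def using \<rho>_pos[of m] by (intro SUP_upper) auto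
    finally show ?thesis .
  qed
  show ?thesis
  proof (cases "hausdorff_measure s (\<Inter>k. level k)")
    case (real r)
    obtain m :: nat where m: "m > 3 * B * (4 * r + 1)" using reals_Archimedean2 by blast
    have "0 \<le> 3 * B * (4 * r + 1)" using B_ge_1 real(1) by simp
    then have "1 \<le> m" using m by (cases m) auto
    from low[OF this] have "(m / (3 * B) - 1) / 4 \<le> r"
      unfolding real(2) using real(1) by (simp add: ennreal_le_iff)
    then have "m / (3 * B) \<le> 4 * r + 1" by simp
    then have "m \<le> 3 * B * (4 * r + 1)" using B_ge_1 by (simp add: field_simps)
    then show ?thesis using m by simp
  qed simp
qed

end

section \<open>A Cantor set of well approximable numbers\<close>

lemma fractions_separated:
  fixes p p' :: int and q q' Q :: nat
  assumes "1 \<le> q" "q \<le> Q" "1 \<le> q'" "q' \<le> Q" and neq: "p / q \<noteq> p' / q'"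
  shows "1 / (real Q)\<^sup>2 \<le> \<bar>p / q - p' / q'\<bar>"
proof -
  have eq: "p / q - p' / q' = (p * int q' - p' * int q) / (real q * real q')"
    using assms by (simp add: field_simps)
  then have "p * int q' - p' * int q \<noteq> 0" using neq assms(1,3)
    by (metis diff_self div_0 eq_iff_diff_eq_0 of_int_0 of_int_diff of_int_mult of_int_of_nat_eq)
  then have "1 \<le> \<bar>p * int q' - p' * int q\<bar>" by linarith
  then have "1 \<le> \<bar>real_of_int (p * int q' - p' * int q)\<bar>" by linarith
  moreover have "real q * real q' \<le> (real Q)\<^sup>2"
    unfolding power2_eq_square using assms by (intro mult_mono) auto
  ultimately have "1 / (real Q)\<^sup>2 \<le> \<bar>real_of_int (p * int q' - p' * int q)\<bar> / (real q * real q')"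
    using assms by (intro frac_le) auto
  then show ?thesis unfolding eq by (simp add: abs_divide abs_mult)
qed

text \<open>
Radius \<open>\<rho>' = Q\<^sup>-\<^sup>\<beta>\<close> with \<open>\<beta> = 2 / (1 - w)\<close> produces ratios close to \<open>w\<close>, and every condition holds for
all large \<open>Q\<close>. The decisive one is the mass bound by \<open>K\<close>: since the number of children is proportional to \<open>\<rho> Q\<^sup>2\<close>, it
asks that \<open>Q\<close> to the power \<open>2 - \<beta> (1 - z)\<close> be large, and this exponent is positive precisely because
\<open>w < z\<close>. Approaching \<open>z\<close> from below is therefore what yields infinite measure at the critical exponent.
\<close>

lemma exists_next_scale:
  fixes w z \<rho> M K \<epsilon> :: real
  assumes w: "0 < w" "w < z" "z \<le> 1" and "0 < \<rho>" "0 < M" "0 < \<epsilon>"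
  shows "\<exists>(Q::nat) \<rho>' N. 1 \<le> Q \<and> K \<le> Q \<and> 0 < \<rho>' \<and> 4 * \<rho>' \<le> \<rho> \<and> 8 * (real Q)\<^sup>2 * \<rho>' < 1 \<and>
           \<rho> \<le> 64 * real N * (1 / (real Q)\<^sup>2) \<and> K \<le> M * real N * \<rho>' powr (1 - z) \<and>
           w - \<epsilon> \<le> 1 - (2 * ln (2 * real Q) + ln 3) / (- ln (2 * \<rho>')) \<and>
           (\<forall>c. \<exists>S. finite S \<and> S \<subseteq> {c..c + \<rho> / 2} \<and>
              (\<forall>y\<in>S. \<exists>(p::int) (q::nat). 1 \<le> q \<and> q \<le> Q \<and> y = p / q) \<and> card S = N)"
proof -
  define \<beta> where "\<beta> = 2 / (1 - w)"
  define s where "s = 1 - z"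
  have \<beta>: "\<beta> > 2" "\<beta> * s < 2" and \<beta>w: "1 - 2 * inverse \<beta> = w"
    using w by (simp_all add: \<beta>_def s_def field_simps)
  obtain Q0 where Q0: "\<And>Q c. Q \<ge> Q0 \<Longrightarrow> \<exists>S. finite S \<and> S \<subseteq> {c..c + \<rho> / 2} \<and>
           (\<forall>y\<in>S. \<exists>(p::int) (q::nat). 1 \<le> q \<and> q \<le> Q \<and> y = p / q) \<and>
           card S = nat \<lfloor>\<rho> / 2 * (real Q)\<^sup>2 / 16\<rfloor>"
    using many_rationals_in_interval[of "\<rho> / 2"] \<open>0 < \<rho>\<close> by force
  have "((\<lambda>Q::nat. 1 - (2 * ln (2 * real Q) + ln 3) / (- ln (2 * real Q powr - \<beta>))) \<longlongrightarrow>
      1 - 2 * inverse \<beta>) at_top"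
    using \<beta> by real_asymp
  then have "\<forall>\<^sub>F Q::nat in at_top. w - \<epsilon> < 1 - (2 * ln (2 * real Q) + ln 3) / (- ln (2 * real Q powr - \<beta>))"
    unfolding \<beta>w using \<open>0 < \<epsilon>\<close> by (intro order_tendstoD(1)) auto
  moreover have "\<forall>\<^sub>F Q::nat in at_top. 4 * real Q powr - \<beta> \<le> \<rho>"
    using \<open>0 < \<rho>\<close> \<beta> by real_asymp
  moreover have "\<forall>\<^sub>F Q::nat in at_top. 8 * (real Q)\<^sup>2 * real Q powr - \<beta> < 1"
    using \<beta> by real_asymp
  moreover have "\<forall>\<^sub>F Q::nat in at_top. \<rho> * (real Q)\<^sup>2 / 64 \<le> \<rho> / 2 * (real Q)\<^sup>2 / 16 - 1"
    using \<open>0 < \<rho>\<close> by real_asymp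
  moreover have "\<forall>\<^sub>F Q::nat in at_top. K \<le> M * (\<rho> / 64) * real Q powr (2 - \<beta> * s)"
    using \<beta> \<open>0 < M\<close> \<open>0 < \<rho>\<close> by real_asymp
  moreover have "\<forall>\<^sub>F Q::nat in at_top. K \<le> real Q" by real_asymp
  moreover have "\<forall>\<^sub>F Q::nat in at_top. max 1 Q0 \<le> Q" by (rule eventually_ge_at_top)
  ultimately have "\<forall>\<^sub>F Q::nat in at_top.
      w - \<epsilon> < 1 - (2 * ln (2 * real Q) + ln 3) / (- ln (2 * real Q powr - \<beta>)) \<and>
      4 * real Q powr - \<beta> \<le> \<rho> \<and> 8 * (real Q)\<^sup>2 * real Q powr - \<beta> < 1 \<and>
      \<rho> * (real Q)\<^sup>2 / 64 \<le> \<rho> / 2 * (real Q)\<^sup>2 / 16 - 1 \<and>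
      K \<le> M * (\<rho> / 64) * real Q powr (2 - \<beta> * s) \<and> K \<le> real Q \<and> max 1 Q0 \<le> Q"
    by eventually_elim blast
  then obtain Q :: nat where Q:
      "w - \<epsilon> < 1 - (2 * ln (2 * real Q) + ln 3) / (- ln (2 * real Q powr - \<beta>))"
      "4 * real Q powr - \<beta> \<le> \<rho>" "8 * (real Q)\<^sup>2 * real Q powr - \<beta> < 1"
      "\<rho> * (real Q)\<^sup>2 / 64 \<le> \<rho> / 2 * (real Q)\<^sup>2 / 16 - 1"
      "K \<le> M * (\<rho> / 64) * real Q powr (2 - \<beta> * s)" "K \<le> real Q" "1 \<le> Q" "Q0 \<le> Q"
    unfolding eventually_sequentially by (metis max.bounded_iff order_refl)
  define \<rho>' where "\<rho>' = real Q powr - \<beta>"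
  define N where "N = nat \<lfloor>\<rho> / 2 * (real Q)\<^sup>2 / 16\<rfloor>"
  have N: "\<rho> * (real Q)\<^sup>2 / 64 \<le> real N" using Q(4) unfolding N_def by linarith
  have "K \<le> M * (\<rho> / 64) * real Q powr (2 - \<beta> * s)" by (rule Q(5))
  also have "real Q powr (2 - \<beta> * s) = (real Q)\<^sup>2 * \<rho>' powr s"
  proof -
    have "real Q powr (2 - \<beta> * s) = real Q powr 2 * real Q powr (- \<beta> * s)"
      unfolding powr_add[symmetric] by simp
    also have "real Q powr (- \<beta> * s) = \<rho>' powr s"
      unfolding \<rho>'_def powr_powr ..
    finally show ?thesis using Q(7) by (simp add: powr_numeral)
  qed
  also have "M * (\<rho> / 64) * ((real Q)\<^sup>2 * \<rho>' powr s) = M * (\<rho> * (real Q)\<^sup>2 / 64) * \<rho>' powr s" by simp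
  also have "\<dots> \<le> M * real N * \<rho>' powr s"
    using N \<open>0 < M\<close> by (intro mult_right_mono mult_left_mono) auto
  finally have K: "K \<le> M * real N * \<rho>' powr s" .
  have "0 < \<rho>'" using Q(7) by (simp add: \<rho>'_def)
  moreover have "\<rho> \<le> 64 * real N * (1 / (real Q)\<^sup>2)"
    using N Q(7) by (simp add: field_simps)
  ultimately show ?thesis
    using Q(2,3,6,7) less_imp_le[OF Q(1)] K[unfolded s_def] Q0[OF Q(8), folded N_def]
    unfolding \<rho>'_def[symmetric] by blast
qed

text \<open>
A state of the construction consists of the left endpoints \<open>C\<close>, the length \<open>\<rho>\<close> and the bound \<open>Q\<close>
on denominators. The intervals start at distance \<open>\<rho>\<close> from their fraction \<open>p / q\<close>, not at the
fraction itself; points of the Cantor set thus never coincide with one of these fractions, which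
makes them irrational. The final clause, on the ratios, is empty at level \<open>0\<close>, where \<open>1 / k\<close> has no
meaning.
\<close>

definition approx_level :: "real \<Rightarrow> nat \<Rightarrow> real set \<times> real \<times> nat \<Rightarrow> bool" where
  "approx_level z k = (\<lambda>(C, \<rho>, Q).
     finite C \<and> C \<noteq> {} \<and> 0 < \<rho> \<and> 1 \<le> Q \<and> k \<le> Q \<and> 8 * (real Q)\<^sup>2 * \<rho> < 1 \<and>
     (\<forall>c\<in>C. {c..c + \<rho>} \<subseteq> {0<..<1}) \<and>
     (\<forall>c\<in>C. \<exists>(p::int) (q::nat). 1 \<le> q \<and> q \<le> Q \<and> c = p / q + \<rho>) \<and>
     real k \<le> card C * \<rho> powr (1 - z) \<and>
     (0 < k \<longrightarrow> z * (k / (k + 1)) - 1 / k \<le> 1 - (2 * ln (2 * real Q) + ln 3) / (- ln (2 * \<rho>))))"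

definition approx_refines :: "real set \<times> real \<times> nat \<Rightarrow> real set \<times> real \<times> nat \<Rightarrow> nat \<Rightarrow> bool" where
  "approx_refines = (\<lambda>(C, \<rho>, Q) (C', \<rho>', Q') N.
     card C' = N * card C \<and> \<rho> \<le> 64 * real N * (1 / (real Q')\<^sup>2) \<and>
     (\<forall>c\<in>C. card {c' \<in> C'. {c'..c' + \<rho>'} \<subseteq> {c..c + \<rho>}} \<le> N) \<and>
     (\<forall>c'\<in>C'. \<exists>c\<in>C. {c'..c' + \<rho>'} \<subseteq> {c..c + \<rho>}))"

lemma approx_level_fraction:
  assumes "approx_level z k (C, \<rho>, Q)" "c \<in> C"
  shows "\<exists>(p::int) (q::nat). 1 \<le> q \<and> q \<le> Q \<and> c = p / q + \<rho>"
  using assms unfolding approx_level_def prod.case by blast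

lemma approx_level_separated:
  assumes "approx_level z k (C, \<rho>, Q)" "c \<in> C" "c' \<in> C" "c \<noteq> c'"
  shows "1 / (real Q)\<^sup>2 \<le> \<bar>c - c'\<bar>"
proof -
  obtain p q p' q' where "c = real_of_int p / real q + \<rho>" "c' = real_of_int p' / real q' + \<rho>"
      "1 \<le> q" "q \<le> Q" "1 \<le> q'" "q' \<le> Q"
    using approx_level_fraction[OF assms(1)] assms(2,3) by metis
  then show ?thesis using fractions_separated[of q Q q' p p'] assms(4) by auto
qed

text \<open>
Each interval of length \<open>\<rho>\<close> receives children at \<open>N\<close> fractions in its left half; the right half
leaves room for the shift by \<open>\<rho>'\<close> and for the length \<open>\<rho>'\<close>. Intervals of one level are disjoint, since
their separation \<open>1 / Q\<^sup>2\<close> exceeds \<open>8 \<rho>\<close>, so children of different parents are different.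
\<close>

lemma approx_level_extend:
  assumes z: "0 < z" "z \<le> 1" and lev: "approx_level z k (C, \<rho>, Q)"
  shows "\<exists>D N. approx_level z (Suc k) D \<and> approx_refines (C, \<rho>, Q) D N"
proof -
  define w where "w = z * (real (Suc k) / (real (Suc k) + 1))"
  have "0 < real (Suc k) / (real (Suc k) + 1)" "real (Suc k) / (real (Suc k) + 1) < 1" by simp_all
  then have w: "0 < w" "w < z"
    using z(1) mult_strict_left_mono[OF _ z(1), of _ 1] unfolding w_def
    by (metis mult_pos_pos, metis mult.right_neutral)
  have C: "finite C" "C \<noteq> {}" "0 < \<rho>" "1 \<le> Q" "8 * (real Q)\<^sup>2 * \<rho> < 1"
    using lev unfolding approx_level_def prod.case by blast+
  have "0 < real (card C)" using C by (simp add: card_gt_0_iff)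
  then obtain Q' :: nat and \<rho>' :: real and N :: nat where
      *: "1 \<le> Q'" "real (Suc k) \<le> Q'" "0 < \<rho>'" "4 * \<rho>' \<le> \<rho>" "8 * (real Q')\<^sup>2 * \<rho>' < 1"
      "\<rho> \<le> 64 * real N * (1 / (real Q')\<^sup>2)" "real (Suc k) \<le> card C * real N * \<rho>' powr (1 - z)"
      "w - 1 / Suc k \<le> 1 - (2 * ln (2 * real Q') + ln 3) / (- ln (2 * \<rho>'))"
      and ex: "\<And>c. \<exists>S. finite S \<and> S \<subseteq> {c..c + \<rho> / 2} \<and>
              (\<forall>y\<in>S. \<exists>(p::int) (q::nat). 1 \<le> q \<and> q \<le> Q' \<and> y = p / q) \<and> card S = N"
    using exists_next_scale[OF w z(2) C(3), of "real (card C)" "1 / Suc k" "real (Suc k)"] by auto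
  obtain S where S: "\<And>c. finite (S c)" "\<And>c. S c \<subseteq> {c..c + \<rho> / 2}" "\<And>c. card (S c) = N"
      "\<And>c y. y \<in> S c \<Longrightarrow> \<exists>(p::int) (q::nat). 1 \<le> q \<and> q \<le> Q' \<and> y = p / q"
    using ex by metis
  define T where "T c = (\<lambda>y. y + \<rho>') ` S c" for c
  have T: "finite (T c)" "card (T c) = N" for c
    by (simp_all add: T_def S card_image)
  have T_in: "{c'..c' + \<rho>'} \<subseteq> {c..c + \<rho>}" if "c' \<in> T c" for c c'
    using that S(2)[of c] *(3,4) by (auto simp: T_def subset_iff)
  define C' where "C' = (\<Union>c\<in>C. T c)"
  have sep: "c1 = c2" if "c1 \<in> C" "c2 \<in> C" "c' \<in> {c1..c1 + \<rho>}" "c' \<in> {c2..c2 + \<rho>}" for c1 c2 c'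
  proof (rule ccontr)
    assume "c1 \<noteq> c2"
    then have "1 / (real Q)\<^sup>2 \<le> \<bar>c1 - c2\<bar>" using approx_level_separated[OF lev] that by blast
    also have "\<dots> \<le> \<rho>" using that by auto
    finally have "1 \<le> (real Q)\<^sup>2 * \<rho>" using C(4) by (simp add: field_simps)
    then show False using C(5) by simp
  qed
  have inT: "c' \<in> {c..c + \<rho>}" if "c' \<in> T c" for c c'
    using T_in[OF that] *(3) by auto
  have card: "card C' = N * card C"
  proof -
    have "card C' = (\<Sum>c\<in>C. card (T c))"
      unfolding C'_def using sep inT by (intro card_UN_disjoint C) (auto simp: T, blast)
    then show ?thesis by (simp add: T)
  qed
  have "N \<noteq> 0" using *(7) by (intro notI) simp
  then have C'_ne: "C' \<noteq> {}" using card C by (metis card.empty card_0_eq mult_eq_0_iff)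
  have children: "card {c' \<in> C'. {c'..c' + \<rho>'} \<subseteq> {c..c + \<rho>}} \<le> N" if c: "c \<in> C" for c
  proof -
    have "{c' \<in> C'. {c'..c' + \<rho>'} \<subseteq> {c..c + \<rho>}} \<subseteq> T c"
    proof safe
      fix c' assume c': "c' \<in> C'" "{c'..c' + \<rho>'} \<subseteq> {c..c + \<rho>}"
      then obtain c2 where c2: "c2 \<in> C" "c' \<in> T c2" by (auto simp: C'_def)
      have "c' \<in> {c..c + \<rho>}" using c'(2) *(3) by auto
      then have "c = c2" using sep[OF c c2(1)] inT[OF c2(2)] by blast
      then show "c' \<in> T c" using c2 by simp
    qed
    then have "card {c' \<in> C'. {c'..c' + \<rho>'} \<subseteq> {c..c + \<rho>}} \<le> card (T c)"
      by (intro card_mono T)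
    then show ?thesis by (simp add: T)
  qed
  have "approx_level z (Suc k) (C', \<rho>', Q')"
    unfolding approx_level_def prod.case
  proof (intro conjI ballI impI)
    show "finite C'" using C(1) T by (simp add: C'_def)
    show "real (Suc k) \<le> card C' * \<rho>' powr (1 - z)"
      using *(7) by (simp add: card mult_ac)
    show "\<exists>(p::int) (q::nat). 1 \<le> q \<and> q \<le> Q' \<and> c' = p / q + \<rho>'" if "c' \<in> C'" for c'
      using that S(4) unfolding C'_def T_def by blast
    show "Suc k \<le> Q'" using *(2) by simp
    show "{c'..c' + \<rho>'} \<subseteq> {0<..<1}" if c': "c' \<in> C'" for c'
    proof -
      obtain c where "c \<in> C" "c' \<in> T c" using c' by (auto simp: C'_def)
      then show ?thesis using T_in lev unfolding approx_level_def prod.case by blast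
    qed
  qed (use * C'_ne in \<open>auto simp: w_def\<close>)
  moreover have "approx_refines (C, \<rho>, Q) (C', \<rho>', Q') N"
    unfolding approx_refines_def prod.case
    using *(6) card children T_in by (auto simp: C'_def)
  ultimately show ?thesis by blast
qed

lemma approx_level_0: "approx_level z 0 ({1/16}, 1/16, 1)"
  unfolding approx_level_def by (auto intro!: exI[of _ "0::int"] exI[of _ "1::nat"])

text \<open>
The fraction \<open>p / q\<close> is a convergent with \<open>q\<^sub>n \<le> 2 Q\<close> by Legendre's criterion, and the lower bound for the
ratio decreases in \<open>q\<^sub>n\<close> and increases as the error shrinks.
\<close>

lemma cf_ratio_ge_of_approx:
  fixes p :: int and q Q :: nat
  assumes x: "x \<in> {0<..<1} - \<rat>" and q: "1 \<le> q" "q \<le> Q"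
    and near: "\<bar>x - p / q\<bar> \<le> 2 * \<rho>" and \<rho>: "0 < \<rho>" "8 * (real Q)\<^sup>2 * \<rho> < 1"
  shows "\<exists>n. cf_convergent x n = p / q \<and>
           1 - (2 * ln (2 * real Q) + ln 3) / (- ln (2 * \<rho>)) \<le> cf_ratio x n"
proof -
  have "real q ^ 2 * (8 * \<rho>) \<le> (real Q)\<^sup>2 * (8 * \<rho>)"
    using q \<rho> by (intro mult_right_mono power_mono) auto
  then have small: "8 * (real q)\<^sup>2 * \<rho> < 1" using \<rho> by linarith
  then have "2 * \<rho> < 1 / (4 * (real q)\<^sup>2)" using q by (simp add: field_simps)
  then have "\<bar>x - p / q\<bar> < 1 / (4 * (real q)\<^sup>2)" using near by linarith
  then obtain n where n: "conv_den x n \<le> 2 * q" "cf_convergent x n = p / q"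
    using close_fraction_is_convergent[OF x q(1), of p] by auto
  define e where "e = \<bar>x - cf_convergent x n\<bar>"
  have e: "0 < e" "e \<le> 2 * \<rho>"
    using cf_convergent_neq[OF x, of n] near by (auto simp: e_def n(2))
  have "(1::real) \<le> (real q)\<^sup>2" using q by simp
  then have "8 * \<rho> \<le> 8 * (real q)\<^sup>2 * \<rho>" using \<rho>(1) by simp
  then have "2 * \<rho> < 1" using small \<rho>(1) by linarith
  then have \<Lambda>: "0 < - ln (2 * \<rho>)" "- ln (2 * \<rho>) \<le> - ln e" using e \<rho> by simp_all
  have den: "1 \<le> conv_den x n" by (rule conv_den_pos[OF x])
  have "real (conv_den x n) \<le> 2 * real Q" using n(1) q(2) by linarith
  then have "ln (conv_den x n) \<le> ln (2 * real Q)" using den by simp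
  moreover have "0 \<le> ln (real (conv_den x n))" using den by simp
  ultimately have "(2 * ln (conv_den x n) + ln 3) / (- ln e) \<le>
      (2 * ln (2 * real Q) + ln 3) / (- ln (2 * \<rho>))"
    using \<Lambda> by (intro frac_le) auto
  then have "1 - (2 * ln (2 * real Q) + ln 3) / (- ln (2 * \<rho>)) \<le> cf_ratio x n"
    using cf_ratio_bounds(3)[OF x, of n] unfolding e_def by linarith
  then show ?thesis using n(2) by blast
qed

text \<open>
The Cantor set built with the ratios \<open>w\<^sub>k = z k / (k + 1)\<close>, which increase to \<open>z\<close>. Each of
its points has, for every \<open>k\<close>, a fraction \<open>p / q\<close> with \<open>q \<le> Q k\<close> at a distance between \<open>\<rho> k\<close> and
\<open>2 \<rho> k\<close>; the upper bound makes the ratios large, the lower bound makes the point irrational.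
\<close>

lemma limsup_cf_ratio_ge_measure:
  assumes z: "0 < z" "z \<le> 1"
  shows "hausdorff_measure (1 - z)
           {x \<in> {0<..<1} - \<rat>. ereal z \<le> limsup (\<lambda>n. ereal (cf_ratio x n))} = \<infinity>"
    (is "hausdorff_measure _ ?W = _")
proof -
  have "\<exists>D. \<forall>k. approx_level z k (D k) \<and> (\<exists>N. approx_refines (D k) (D (Suc k)) N)"
  proof (rule dependent_nat_choice)
    show "\<exists>D. approx_level z 0 D" using approx_level_0 by blast
  next
    fix D k assume "approx_level z k D"
    then show "\<exists>D'. approx_level z (Suc k) D' \<and> (\<exists>N. approx_refines D D' N)"
      using approx_level_extend[OF z] by (cases D) blast
  qed
  then obtain D M where lev: "\<And>k. approx_level z k (D k)" and ref: "\<And>k. approx_refines (D k) (D (Suc k)) (M k)"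
    by metis
  define C \<rho> Q where "C k = fst (D k)" and "\<rho> k = fst (snd (D k))" and "Q k = snd (snd (D k))" for k
  have D: "D k = (C k, \<rho> k, Q k)" for k by (simp add: C_def \<rho>_def Q_def)
  note lev' = lev[unfolded D]
  have l: "finite (C k)" "C k \<noteq> {}" "0 < \<rho> k" "1 \<le> Q k" "k \<le> Q k" "8 * (real (Q k))\<^sup>2 * \<rho> k < 1"
      "real k \<le> card (C k) * \<rho> k powr (1 - z)" for k
    using lev'[of k] unfolding approx_level_def prod.case by blast+
  have ratio: "z * (k / (k + 1)) - 1 / k \<le>
      1 - (2 * ln (2 * real (Q k)) + ln 3) / (- ln (2 * \<rho> k))" if "0 < k" for k
    using lev'[of k] that unfolding approx_level_def prod.case by blast
  have r: "card (C (Suc k)) = M k * card (C k)" "\<rho> k \<le> 64 * real (M k) * (1 / (real (Q (Suc k)))\<^sup>2)"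
      "c \<in> C k \<Longrightarrow> card {c' \<in> C (Suc k). {c'..c' + \<rho> (Suc k)} \<subseteq> {c..c + \<rho> k}} \<le> M k"
      "c' \<in> C (Suc k) \<Longrightarrow> \<exists>c\<in>C k. {c'..c' + \<rho> (Suc k)} \<subseteq> {c..c + \<rho> k}" for k c c'
    using ref[of k] unfolding D approx_refines_def prod.case by blast+
  have \<rho>0: "\<rho> \<longlonglongrightarrow> 0"
  proof (rule Lim_null_comparison[OF _ lim_inverse_n])
    have "norm (\<rho> k) \<le> inverse (real k)" if "1 \<le> k" for k
    proof -
      have "real k * 1 \<le> real (Q k) * real (Q k)" using l(4,5)[of k] by (intro mult_mono) auto
      then have "real k * \<rho> k \<le> (real (Q k))\<^sup>2 * \<rho> k"
        using l(3)[of k] unfolding power2_eq_square by (intro mult_right_mono) auto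
      also have "\<dots> \<le> 1" using l(3,6)[of k] by (simp add: mult.assoc)
      finally show ?thesis using that l(3)[of k] by (simp add: field_simps)
    qed
    then show "\<forall>\<^sub>F k in sequentially. norm (\<rho> k) \<le> inverse (real k)"
      unfolding eventually_sequentially by blast
  qed
  interpret cantor_scheme C \<rho> "\<lambda>k. 1 / (real (Q k))\<^sup>2" "\<lambda>k. M (k - 1)" "1 - z" 64
  proof
    show "1 / (real (Q k))\<^sup>2 \<le> \<bar>c - c'\<bar>" if "c \<in> C k" "c' \<in> C k" "c \<noteq> c'" for k c c'
      by (rule approx_level_separated[OF lev' that])
    show "0 < 1 / (real (Q k))\<^sup>2" for k using l(4)[of k] by simp
  qed (use l r \<rho>0 z in auto)
  have "(\<Inter>k. level k) \<subseteq> ?W"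
  proof
    fix x assume "x \<in> (\<Inter>k. level k)"
    then have xk: "\<exists>c\<in>C k. x \<in> {c..c + \<rho> k}" for k by (auto simp: level_def)
    have approx: "\<exists>(p::int) (q::nat). 1 \<le> q \<and> q \<le> Q k \<and> \<rho> k \<le> \<bar>x - p / q\<bar> \<and> \<bar>x - p / q\<bar> \<le> 2 * \<rho> k" for k
    proof -
      obtain c where c: "c \<in> C k" "x \<in> {c..c + \<rho> k}" using xk by blast
      obtain p :: int and q :: nat where pq: "1 \<le> q" "q \<le> Q k" "c = p / q + \<rho> k"
        using approx_level_fraction[OF lev' c(1)] by blast
      have "\<rho> k \<le> x - p / q" "x - p / q \<le> 2 * \<rho> k" using c(2) unfolding pq(3) by auto
      then show ?thesis using pq(1,2) l(3)[of k] by (intro exI[of _ p] exI[of _ q]) auto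
    qed
    have "x \<in> {0<..<1}" using xk[of 0] lev'[of 0] unfolding approx_level_def prod.case by blast
    moreover have "x \<notin> \<rat>"
    proof
      \<comment> \<open>If \<open>x\<close> had denominator \<open>b\<close>, then at level \<open>b\<close>, where \<open>b \<le> Q b\<close>, it would be one of the fractions
        of denominator at most \<open>Q b\<close>, whose separation exceeds \<open>2 \<rho> b\<close>.\<close>
      assume "x \<in> \<rat>"
      then obtain a b :: int where ab: "0 < b" "x = a / b" by (rule Rats_cases') auto
      define k where "k = nat b"
      obtain p :: int and q :: nat where pq: "1 \<le> q" "q \<le> Q k" "\<rho> k \<le> \<bar>x - p / q\<bar>" "\<bar>x - p / q\<bar> \<le> 2 * \<rho> k"
        using approx by blast
      have x: "x = a / real k" using ab by (simp add: k_def)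
      have "1 / (real (Q k))\<^sup>2 \<le> \<bar>a / real k - p / q\<bar>"
        by (rule fractions_separated) (use pq x l(3,5)[of k] ab(1) in \<open>auto simp: k_def\<close>)
      also have "\<dots> \<le> 2 * \<rho> k" using pq(4) x by simp
      finally have "1 \<le> 2 * (real (Q k))\<^sup>2 * \<rho> k" using l(4)[of k] by (simp add: field_simps)
      then show False using l(6)[of k] by linarith
    qed
    ultimately have x: "x \<in> {0<..<1} - \<rat>" by simp
    have "ereal z \<le> limsup (\<lambda>n. ereal (cf_ratio x n))"
    proof (rule ccontr)
      assume "\<not> ?thesis"
      then have "limsup (\<lambda>n. ereal (cf_ratio x n)) < ereal z" by simp
      then obtain y where y: "limsup (\<lambda>n. ereal (cf_ratio x n)) < ereal y" "y < z"
        using ereal_dense2 by fastforce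
      then have "\<forall>\<^sub>F n in sequentially. ereal (cf_ratio x n) < ereal y"
        by (intro Limsup_lessD)
      then obtain n0 where n0: "\<And>n. n \<ge> n0 \<Longrightarrow> cf_ratio x n < y"
        unfolding eventually_sequentially by auto
      have "(\<lambda>k. z * (real k / (real k + 1)) - 1 / real k) \<longlonglongrightarrow> z"
        by real_asymp
      then have "\<forall>\<^sub>F k in sequentially. y < z * (real k / (real k + 1)) - 1 / real k"
        using y(2) by (rule order_tendstoD)
      \<comment> \<open>The convergents supplied by deep levels have large index: each of the finitely many convergents
        before \<open>n0\<close> keeps a positive distance from \<open>x\<close>.\<close>
      moreover have "\<forall>\<^sub>F k in sequentially. \<forall>m\<in>{..<n0}. 2 * \<rho> k < \<bar>x - cf_convergent x m\<bar>"
      proof (intro eventually_ball_finite ballI)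
        fix m
        have "(\<lambda>k. 2 * \<rho> k) \<longlonglongrightarrow> 2 * 0" by (intro tendsto_intros \<rho>0)
        then show "\<forall>\<^sub>F k in sequentially. 2 * \<rho> k < \<bar>x - cf_convergent x m\<bar>"
          by (rule order_tendstoD(2)) (use cf_convergent_neq[OF x, of m] in auto)
      qed simp
      moreover have "\<forall>\<^sub>F k :: nat in sequentially. 0 < k" by (rule eventually_gt_at_top)
      ultimately have "\<forall>\<^sub>F k in sequentially. y < z * (real k / (real k + 1)) - 1 / real k \<and>
          (\<forall>m\<in>{..<n0}. 2 * \<rho> k < \<bar>x - cf_convergent x m\<bar>) \<and> 0 < k"
        by eventually_elim blast
      then obtain k where k: "y < z * (real k / (real k + 1)) - 1 / real k"
          "\<And>m. m < n0 \<Longrightarrow> 2 * \<rho> k < \<bar>x - cf_convergent x m\<bar>" "0 < k"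
        unfolding eventually_sequentially by blast
      obtain p :: int and q :: nat where pq: "1 \<le> q" "q \<le> Q k" "\<bar>x - p / q\<bar> \<le> 2 * \<rho> k"
        using approx by blast
      obtain n where n: "cf_convergent x n = p / q"
          "1 - (2 * ln (2 * real (Q k)) + ln 3) / (- ln (2 * \<rho> k)) \<le> cf_ratio x n"
        using cf_ratio_ge_of_approx[OF x pq l(3,6)] by blast
      have "\<not> n < n0" using k(2)[of n] pq(3) unfolding n(1) by linarith
      then show False using n0[of n] n(2) ratio[OF k(3)] k(1) by simp
    qed
    then show "x \<in> ?W" using x by blast
  qed
  then have "hausdorff_measure (1 - z) (\<Inter>k. level k) \<le> hausdorff_measure (1 - z) ?W"
    by (rule hausdorff_measure_mono)
  then show ?thesis unfolding hausdorff_measure_infinite by (simp add: top_unique)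
qed

section \<open>Numbers of exact order\<close>

text \<open>
On the set where the limes superior is at least \<open>z\<close>, it either equals \<open>z\<close> or exceeds some
\<open>z + 1 / (j + 1)\<close>. At the exponent \<open>1 - z\<close> each of the latter sets is null.
\<close>

lemma F_set_measure_infinite:
  assumes z: "0 < z" "z \<le> 1"
  shows "hausdorff_measure (1 - z) (F_set z) = \<infinity>"
proof -
  define N where "N j = {x \<in> {0<..<1} - \<rat>. ereal (z + 1 / Suc j) < limsup (\<lambda>n. ereal (cf_ratio x n))}"
    for j
  let ?W = "{x \<in> {0<..<1} - \<rat>. ereal z \<le> limsup (\<lambda>n. ereal (cf_ratio x n))}"
  have "?W \<subseteq> F_set z \<union> (\<Union>j. N j)"
  proof
    fix x assume "x \<in> ?W"
    then have x: "x \<in> {0<..<1} - \<rat>" and ge: "ereal z \<le> limsup (\<lambda>n. ereal (cf_ratio x n))" by auto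
    obtain l where l: "limsup (\<lambda>n. ereal (cf_ratio x n)) = ereal l"
      using limsup_cf_ratio_range[OF x] by (cases "limsup (\<lambda>n. ereal (cf_ratio x n))") auto
    show "x \<in> F_set z \<union> (\<Union>j. N j)"
    proof (cases "l = z")
      case True
      then show ?thesis using x l by (auto simp: F_set_eq)
    next
      case False
      then have "0 < l - z" using ge unfolding l by simp
      then obtain j where "1 / real (Suc j) < l - z"
        using reals_Archimedean[of "l - z"] by (auto simp: inverse_eq_divide)
      then have "ereal (z + 1 / Suc j) < ereal l" by simp
      then have "x \<in> N j" using x unfolding N_def mem_Collect_eq l by blast
      then show ?thesis by blast
    qed
  qed
  moreover have "hausdorff_measure (1 - z) (N j) = 0" for j
    unfolding N_def using z by (intro limsup_cf_ratio_gt_null) (auto simp: add_pos_pos)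
  ultimately have "hausdorff_measure (1 - z) ?W \<le> hausdorff_measure (1 - z) (F_set z)"
    by (rule hausdorff_measure_le_up_to_null)
  then show ?thesis unfolding limsup_cf_ratio_ge_measure[OF z] by (simp add: top_unique)
qed

lemma F_set_null:
  assumes "0 < z" "1 - z < s"
  shows "hausdorff_measure s (F_set z) = 0"
proof -
  obtain t where t: "max 0 (1 - s) < t" "t < z"
    using dense[of "max 0 (1 - s)" z] assms by auto
  have "F_set z \<subseteq> {x \<in> {0<..<1} - \<rat>. ereal t < limsup (\<lambda>n. ereal (cf_ratio x n))}"
    using t(2) by (auto simp: F_set_eq)
  then have "hausdorff_measure s (F_set z) \<le>
      hausdorff_measure s {x \<in> {0<..<1} - \<rat>. ereal t < limsup (\<lambda>n. ereal (cf_ratio x n))}"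
    by (rule hausdorff_measure_mono)
  also have "\<dots> = 0" by (rule limsup_cf_ratio_gt_null) (use t in auto)
  finally show ?thesis by simp
qed

theorem theorem1:
  fixes z :: real
  shows "(0 < z \<and> z \<le> 1 \<longrightarrow>
            hausdorff_dim (F_set z) = ennreal (1 - z) \<and>
            hausdorff_measure (1 - z) (F_set z) = \<infinity>) \<and>
         (z \<notin> {0..1} \<longrightarrow> F_set z = {})"
proof (intro conjI impI)
  assume z: "0 < z \<and> z \<le> 1"
  then show inf: "hausdorff_measure (1 - z) (F_set z) = \<infinity>"
    by (intro F_set_measure_infinite) auto
  show "hausdorff_dim (F_set z) = ennreal (1 - z)"
    by (rule hausdorff_dim_eqI) (use z inf F_set_null in auto)
qed (rule F_set_empty)

end
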